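(* Let $G=\langle a,b,t \mid t^2=1,\ ab=ba,\ a^t=b\rangle\cong\mathbb{Z}^2\rtimes\mathbb{Z}/2\mathbb{Z}$, and let $c=a^2$, $d=ab$, so that also $G=\langle a,c,d,t\mid ad=da,\ c=a^2,\ t^2=1,\ tat=a^{-1}d\rangle$. Let $X=\{a^{\pm1},c^{\pm1},d^{\pm1},t\}$. Then $\mathsf{ConjGeo}(G,X)$ is regular, but $\mathsf{Geo}(G,X)$ is not. Moreover, for some total orderings of $X$, $\mathsf{ConjSL}(G,X)$ and $\mathsf{ConjMinLenSL}(G,X)$ are regular, but $\mathsf{SL}(G,X)$ is not.
   Context: Here $a^t=t^{-1}at$. For $w\in X^*$, $l(w)$ is its length and $\pi(w)$ the element of $G$ it represents. For $g\in G$, $|g|$ is the length of a shortest word over $X$ representing $g$, and $|g|_c=\min\{|h| : h\text{ conjugate to }g\text{ in }G\}$. $\mathsf{Geo}(G,X)=\{w\in X^* : l(w)=|\pi(w)|\}$ and $\mathsf{ConjGeo}(G,X)=\{w\in X^* : l(w)=|\pi(w)|_c\}$. Given a total ordering of $X$, the shortlex ordering on $X^*$ compares words first by length and then, for equal length, lexicographically; $y_g$ denotes the shortlex least word representing $g\in G$, and $z_\kappa$ the shortlex least word representing an element of the conjugacy class $\kappa$. $\mathsf{SL}(G,X)=\{y_g : g\in G\}$, $\mathsf{ConjMinLenSL}(G,X)=\{y_g : g\in G,\ |g|=|g|_c\}$ and $\mathsf{ConjSL}(G,X)=\{z_\kappa : \kappa\text{ a conjugacy class of }G\}$. A language is regular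 if it is accepted by a finite state automaton. *)

theory Defs
  imports "HOL-Algebra.Elementary_Groups"
begin

section \<open>Groups given by generators and relations\<close>

text \<open>A word over \<open>'x\<close> and the formal inverses of its elements; \<open>(x, True)\<close> stands for
  \<open>x\<close> and \<open>(x, False)\<close> for the inverse of \<open>x\<close>.\<close>

type_synonym 'x gword = "('x \<times> bool) list"

abbreviation pos :: "'x \<Rightarrow> 'x \<times> bool" where "pos x \<equiv> (x, True)"
abbreviation neg :: "'x \<Rightarrow> 'x \<times> bool" where "neg x \<equiv> (x, False)"

text \<open>A set \<open>R\<close> of pairs \<open>(u, v)\<close> stands for the defining relations \<open>u = v\<close>; \<open>word_eq R\<close> is the
  congruence on words generated by \<open>R\<close> and by free cancellation.\<close>

inductive word_eq :: "('x gword \<times> 'x gword) set \<Rightarrow> 'x gword \<Rightarrow> 'x gword \<Rightarrow> bool"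
  for R where
  refl: "word_eq R u u"
| sym: "word_eq R u v \<Longrightarrow> word_eq R v u"
| trans: "word_eq R u v \<Longrightarrow> word_eq R v w \<Longrightarrow> word_eq R u w"
| cancel: "word_eq R (p @ [(x, e), (x, \<not> e)] @ q) (p @ q)"
| relation: "(u, v) \<in> R \<Longrightarrow> word_eq R (p @ u @ q) (p @ v @ q)"

definition word_class :: "('x gword \<times> 'x gword) set \<Rightarrow> 'x gword \<Rightarrow> 'x gword set" where
  "word_class R w = {v. word_eq R w v}"

definition presented_group :: "('x gword \<times> 'x gword) set \<Rightarrow> 'x gword set monoid" where
  "presented_group R =
    \<lparr>carrier = range (word_class R),
     monoid.mult = (\<lambda>A B. {w. \<exists>u\<in>A. \<exists>v\<in>B. word_eq R (u @ v) w}),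
     one = word_class R []\<rparr>"

text \<open>\<open>G\<close> is the group presented by the generators \<open>'x\<close> and the relations \<open>R\<close>, where the
  generator \<open>x\<close> is the element \<open>f x\<close> of \<open>G\<close>.\<close>

definition has_presentation ::
    "('g, 'm) monoid_scheme \<Rightarrow> ('x \<Rightarrow> 'g) \<Rightarrow> ('x gword \<times> 'x gword) set \<Rightarrow> bool" where
  "has_presentation G f R \<longleftrightarrow>
    (\<exists>\<phi> \<in> iso (presented_group R) G. \<forall>x. \<phi> (word_class R [pos x]) = f x)"

lemma word_eq_context: "word_eq R u v \<Longrightarrow> word_eq R (p @ u @ q) (p @ v @ q)"
proof (induction rule: word_eq.induct)
  case (cancel p' x e q')
  then show ?case using word_eq.cancel[of R "p @ p'" x e "q' @ q"] by simp
next
  case (relation u v p' q')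
  then show ?case using word_eq.relation[of u v R "p @ p'" "q' @ q"] by simp
qed (blast intro: word_eq.intros)+

lemma word_eq_append: "word_eq R u u' \<Longrightarrow> word_eq R v v' \<Longrightarrow> word_eq R (u @ v) (u' @ v')"
  using word_eq_context[of R u u' "[]" v] word_eq_context[of R v v' u' "[]"]
  by (auto intro: word_eq.trans)

lemma word_class_eq_iff: "word_class R u = word_class R v \<longleftrightarrow> word_eq R u v"
  unfolding word_class_def by (blast intro: word_eq.intros)

lemma presented_group_mult:
  "word_class R u \<otimes>\<^bsub>presented_group R\<^esub> word_class R v = word_class R (u @ v)"
  unfolding presented_group_def word_class_def
  by (auto intro: word_eq.trans word_eq_append word_eq.refl)

lemma word_eq_inverse: "word_eq R (rev (map (\<lambda>(x, e). (x, \<not> e)) w) @ w) []"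
proof (induction w)
  case Nil
  show ?case by (simp add: word_eq.refl)
next
  case (Cons l w)
  obtain x e where l: "l = (x, e)" by (cases l)
  let ?i = "rev (map (\<lambda>(x, e). (x, \<not> e)) w)"
  have "word_eq R (?i @ [(x, \<not> e), (x, \<not> \<not> e)] @ w) (?i @ w)" by (rule word_eq.cancel)
  with Cons.IH show ?case by (auto simp: l intro: word_eq.trans)
qed

lemma group_presented_group: "group (presented_group R)"
proof (rule groupI)
  show "\<exists>y\<in>carrier (presented_group R). y \<otimes>\<^bsub>presented_group R\<^esub> x = \<one>\<^bsub>presented_group R\<^esub>"
    if "x \<in> carrier (presented_group R)" for x
  proof -
    from that obtain w where w: "x = word_class R w" by (auto simp: presented_group_def)
    let ?y = "word_class R (rev (map (\<lambda>(x, e). (x, \<not> e)) w))"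
    have "?y \<otimes>\<^bsub>presented_group R\<^esub> x = word_class R []"
      by (simp add: w presented_group_mult word_class_eq_iff word_eq_inverse)
    moreover have "?y \<in> carrier (presented_group R)" "\<one>\<^bsub>presented_group R\<^esub> = word_class R []"
      by (auto simp: presented_group_def)
    ultimately show ?thesis by metis
  qed
next
  fix x y assume "x \<in> carrier (presented_group R)" "y \<in> carrier (presented_group R)"
  then obtain u v where "x = word_class R u" "y = word_class R v"
    by (auto simp: presented_group_def)
  then show "x \<otimes>\<^bsub>presented_group R\<^esub> y \<in> carrier (presented_group R)"
    by (simp add: presented_group_mult) (simp add: presented_group_def)
next
  show "\<one>\<^bsub>presented_group R\<^esub> \<in> carrier (presented_group R)"
    by (simp add: presented_group_def)
next
  fix x y z assume "x \<in> carrier (presented_group R)" "y \<in> carrier (presented_group R)"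
    "z \<in> carrier (presented_group R)"
  then obtain u v w where "x = word_class R u" "y = word_class R v" "z = word_class R w"
    by (auto simp: presented_group_def)
  then show "x \<otimes>\<^bsub>presented_group R\<^esub> y \<otimes>\<^bsub>presented_group R\<^esub> z =
      x \<otimes>\<^bsub>presented_group R\<^esub> (y \<otimes>\<^bsub>presented_group R\<^esub> z)"
    by (simp add: presented_group_mult)
next
  fix x assume "x \<in> carrier (presented_group R)"
  then obtain u where u: "x = word_class R u" by (auto simp: presented_group_def)
  have "\<one>\<^bsub>presented_group R\<^esub> = word_class R []" by (simp add: presented_group_def)
  then show "\<one>\<^bsub>presented_group R\<^esub> \<otimes>\<^bsub>presented_group R\<^esub> x = x"
    by (simp add: u presented_group_mult)
qed

section \<open>The two presentations and the semidirect product\<close>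

datatype gen_abt = Gen_a | Gen_b | Gen_t

definition relations_abt :: "(gen_abt gword \<times> gen_abt gword) set" where
  "relations_abt =
    {([pos Gen_t, pos Gen_t], []),
     ([pos Gen_a, pos Gen_b], [pos Gen_b, pos Gen_a]),
     ([neg Gen_t, pos Gen_a, pos Gen_t], [pos Gen_b])}"

datatype gen_acdt = Gen'_a | Gen'_c | Gen'_d | Gen'_t

definition relations_acdt :: "(gen_acdt gword \<times> gen_acdt gword) set" where
  "relations_acdt =
    {([pos Gen'_a, pos Gen'_d], [pos Gen'_d, pos Gen'_a]),
     ([pos Gen'_c], [pos Gen'_a, pos Gen'_a]),
     ([pos Gen'_t, pos Gen'_t], []),
     ([pos Gen'_t, pos Gen'_a, pos Gen'_t], [neg Gen'_a, pos Gen'_d])}"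

definition semidirect_product ::
    "('h, 'm) monoid_scheme \<Rightarrow> ('k, 'n) monoid_scheme \<Rightarrow> ('k \<Rightarrow> 'h \<Rightarrow> 'h) \<Rightarrow> ('h \<times> 'k) monoid"
  where
  "semidirect_product H K \<alpha> =
    \<lparr>carrier = carrier H \<times> carrier K,
     monoid.mult = (\<lambda>(h, k) (h', k'). (h \<otimes>\<^bsub>H\<^esub> \<alpha> k h', k \<otimes>\<^bsub>K\<^esub> k')),
     one = (\<one>\<^bsub>H\<^esub>, \<one>\<^bsub>K\<^esub>)\<rparr>"

text \<open>The nontrivial element of \<open>integer_mod_group 2\<close> swaps the two coordinates.\<close>

definition swap_action :: "int \<Rightarrow> int \<times> int \<Rightarrow> int \<times> int" where
  "swap_action k p = (if k = 0 then p else (snd p, fst p))"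

section \<open>Lengths and conjugacy\<close>

text \<open>The generating set \<open>X\<close> is a subset of \<open>carrier G\<close>, closed under inverses in the
  application, so that words over \<open>X\<close> are elements of \<open>lists X\<close>.\<close>

definition word_val :: "('g, 'm) monoid_scheme \<Rightarrow> 'g list \<Rightarrow> 'g" where
  "word_val G w = foldr (\<otimes>\<^bsub>G\<^esub>) w \<one>\<^bsub>G\<^esub>"

definition elt_length :: "('g, 'm) monoid_scheme \<Rightarrow> 'g set \<Rightarrow> 'g \<Rightarrow> nat" where
  "elt_length G X g = (LEAST n. \<exists>w\<in>lists X. word_val G w = g \<and> length w = n)"

definition conj_class :: "('g, 'm) monoid_scheme \<Rightarrow> 'g \<Rightarrow> 'g set" where
  "conj_class G g = {inv\<^bsub>G\<^esub> x \<otimes>\<^bsub>G\<^esub> g \<otimes>\<^bsub>G\<^esub> x |x. x \<in> carrier G}"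

definition conj_length :: "('g, 'm) monoid_scheme \<Rightarrow> 'g set \<Rightarrow> 'g \<Rightarrow> nat" where
  "conj_length G X g = (LEAST n. \<exists>h\<in>conj_class G g. elt_length G X h = n)"

section \<open>Languages\<close>

definition Geo :: "('g, 'm) monoid_scheme \<Rightarrow> 'g set \<Rightarrow> 'g list set" where
  "Geo G X = {w \<in> lists X. length w = elt_length G X (word_val G w)}"

definition ConjGeo :: "('g, 'm) monoid_scheme \<Rightarrow> 'g set \<Rightarrow> 'g list set" where
  "ConjGeo G X = {w \<in> lists X. length w = conj_length G X (word_val G w)}"

text \<open>The ordering \<open>r\<close> of the alphabet is reflexive, whereas \<open>lenlex\<close> expects a strict one.\<close>

definition shortlex_le :: "'a rel \<Rightarrow> 'a list \<Rightarrow> 'a list \<Rightarrow> bool" where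
  "shortlex_le r u v \<longleftrightarrow> u = v \<or> (u, v) \<in> lenlex (r - Id)"

definition shortlex_least :: "'a rel \<Rightarrow> 'a list set \<Rightarrow> 'a list" where
  "shortlex_least r W = (THE w. w \<in> W \<and> (\<forall>v\<in>W. shortlex_le r w v))"

definition sl_elt :: "('g, 'm) monoid_scheme \<Rightarrow> 'g set \<Rightarrow> 'g rel \<Rightarrow> 'g \<Rightarrow> 'g list" where
  "sl_elt G X r g = shortlex_least r {w \<in> lists X. word_val G w = g}"

definition sl_class :: "('g, 'm) monoid_scheme \<Rightarrow> 'g set \<Rightarrow> 'g rel \<Rightarrow> 'g set \<Rightarrow> 'g list" where
  "sl_class G X r \<kappa> = shortlex_least r {w \<in> lists X. word_val G w \<in> \<kappa>}"

definition SL :: "('g, 'm) monoid_scheme \<Rightarrow> 'g set \<Rightarrow> 'g rel \<Rightarrow> 'g list set" where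
  "SL G X r = {sl_elt G X r g |g. g \<in> carrier G}"

definition ConjMinLenSL :: "('g, 'm) monoid_scheme \<Rightarrow> 'g set \<Rightarrow> 'g rel \<Rightarrow> 'g list set" where
  "ConjMinLenSL G X r =
    {sl_elt G X r g |g. g \<in> carrier G \<and> elt_length G X g = conj_length G X g}"

definition ConjSL :: "('g, 'm) monoid_scheme \<Rightarrow> 'g set \<Rightarrow> 'g rel \<Rightarrow> 'g list set" where
  "ConjSL G X r = {sl_class G X r \<kappa> |\<kappa>. \<kappa> \<in> conj_class G ` carrier G}"

text \<open>Acceptance by a deterministic finite automaton with alphabet \<open>X\<close>, states \<open>Q\<close>, transition
  function \<open>\<delta>\<close>, initial state \<open>q0\<close> and accepting states \<open>F\<close>. Taking the states to be natural
  numbers is no restriction, since \<open>Q\<close> is finite.\<close>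

definition regular_language :: "'a set \<Rightarrow> 'a list set \<Rightarrow> bool" where
  "regular_language X L \<longleftrightarrow>
    (\<exists>(Q :: nat set) \<delta> q0 F.
       finite Q \<and> q0 \<in> Q \<and> F \<subseteq> Q \<and> (\<forall>q\<in>Q. \<forall>x\<in>X. \<delta> q x \<in> Q) \<and>
       L = {w \<in> lists X. foldl \<delta> q0 w \<in> F})"

end

theory Submission
  imports Defs
begin

text \<open>
  Write the elements of \<open>\<int>\<^sup>2 \<rtimes> \<int>/2\<int>\<close> as \<open>((i, j), k)\<close>. A letter displaces the first or the
  second coordinate according to the parity of the number of letters \<open>t\<close> before it. The word
  \<open>c\<^sup>i t c\<^sup>j t\<close> represents \<open>((2i, 2j), 0)\<close>. If \<open>j \<le> i\<close>, then the word \<open>c\<^bsup>i-j\<^esup> d\<^bsup>2j\<^esup>\<close> without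
  \<open>t\<close> is shorter, but if \<open>i + 2 \<le> j\<close>, then \<open>c\<^sup>i t c\<^sup>j t\<close> is geodesic and, if \<open>c\<close> is the least
  letter, even shortlex least; a finite automaton cannot compare \<open>i\<close> with \<open>j\<close>. Up to conjugacy no
  such comparison is left: the coordinates may be exchanged, and whether a word is a conjugacy
  geodesic depends only on bounded information about the number of its letters of each kind.
  The shortlex least ones among the conjugacy geodesics are then explicit words of the form
  \<open>x\<^sup>p u y\<^sup>q v\<close> with finitely many \<open>x\<close>, \<open>y\<close>, \<open>u\<close>, \<open>v\<close>.
\<close>

section \<open>Languages with finitely many left quotients\<close>

text \<open>No explicit shortest word is ever needed for a general element. The function
  \<open>elt_len\<close> grows by at most 1 with each letter and so bounds lengths from below;
  \<open>conj_len\<close>, obtained from it, is exact on conjugacy classes because every class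
  contains a word that attains it.

  Nor is a normal form compared with all its competitors. Exchanges of a few letters show that every
  shortlex least conjugacy geodesic lies in the list \<open>minlen_nf\<close>, and distinct members
  of the list have distinct values; so the least word with the value of a member can only be that
  member. The same argument yields \<open>class_nf\<close>, with conjugacy in place of equality.

  The gap between j <= i and i + 2 <= j is due to j = i + 1: there c^i t c^j t has the same length
  as c^{-1} d^{2j}, and for i = 0 the latter is smaller.\<close>

definition left_quotient :: "'a list set \<Rightarrow> 'a list \<Rightarrow> 'a list set" where
  "left_quotient L u = {v. u @ v \<in> L}"

abbreviation finitely_many_quotients :: "'a list set \<Rightarrow> bool" where
  "finitely_many_quotients L \<equiv> finite (range (left_quotient L))"

lemma left_quotient_append: "left_quotient L (u @ v) = left_quotient (left_quotient L u) v"
  by (simp add: left_quotient_def)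

text \<open>The left quotients are the states of the minimal automaton (Myhill-Nerode), and an
  injection into the naturals numbers them. The renaming \<open>g\<close> lets an abstract alphabet
  stand for a generating set inside a group.\<close>

lemma regular_language_map:
  assumes fin: "finitely_many_quotients L" and inj: "inj g"
  shows "regular_language (range g) (map g ` L)"
proof -
  define S where "S = range (left_quotient L)"
  obtain f :: "'a list set \<Rightarrow> nat" where f: "inj_on f S"
    using finite_imp_inj_to_nat_seg[of S] fin by (auto simp: S_def)
  have from_nat: "inv_into S f (f (left_quotient L u)) = left_quotient L u" for u
    using f by (simp add: S_def)
  define \<delta> where "\<delta> q x = f (left_quotient (inv_into S f q) [inv_into UNIV g x])" for q x
  have step: "\<delta> (f (left_quotient L u)) (g x) = f (left_quotient L (u @ [x]))" for u x
    by (simp add: \<delta>_def from_nat inj left_quotient_append)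
  have run: "foldl \<delta> (f (left_quotient L u)) (map g w) = f (left_quotient L (u @ w))" for u w
    by (induction w arbitrary: u) (simp_all add: step)
  have words: "lists (range g) = range (map g)"
    by (metis lists_UNIV lists_image)
  have acc: "f (left_quotient L w) \<in> f ` {s \<in> S. [] \<in> s} \<longleftrightarrow> w \<in> L" for w
  proof -
    have "f (left_quotient L w) \<in> f ` {s \<in> S. [] \<in> s} \<longleftrightarrow> left_quotient L w \<in> {s \<in> S. [] \<in> s}"
      by (rule inj_on_image_mem_iff[OF f]) (auto simp: S_def)
    then show ?thesis by (auto simp: S_def left_quotient_def)
  qed
  show ?thesis unfolding regular_language_def
  proof (intro exI conjI)
    show "finite (f ` S)" using fin by (simp add: S_def)
    show "f (left_quotient L []) \<in> f ` S" by (simp add: S_def)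
    show "f ` {s \<in> S. [] \<in> s} \<subseteq> f ` S" by blast
    show "\<forall>q\<in>f ` S. \<forall>x\<in>range g. \<delta> q x \<in> f ` S"
      by (auto simp: S_def step)
    have "{w \<in> lists (range g). foldl \<delta> (f (left_quotient L [])) w \<in> f ` {s \<in> S. [] \<in> s}} =
        map g ` {w. foldl \<delta> (f (left_quotient L [])) (map g w) \<in> f ` {s \<in> S. [] \<in> s}}"
      unfolding words by blast
    also have "\<dots> = map g ` L" using run[of "[]"] acc by simp
    finally show "map g ` L = {w \<in> lists (range g).
        foldl \<delta> (f (left_quotient L [])) w \<in> f ` {s \<in> S. [] \<in> s}}" ..
  qed
qed

lemma finitely_many_quotients_union:
  assumes "finitely_many_quotients A" "finitely_many_quotients B"
  shows "finitely_many_quotients (A \<union> B)"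
proof -
  have "range (left_quotient (A \<union> B)) \<subseteq>
      (\<lambda>(P, Q). P \<union> Q) ` (range (left_quotient A) \<times> range (left_quotient B))"
  proof (rule image_subsetI)
    fix u
    have "left_quotient (A \<union> B) u = (\<lambda>(P, Q). P \<union> Q) (left_quotient A u, left_quotient B u)"
      by (auto simp: left_quotient_def)
    then show "left_quotient (A \<union> B) u \<in>
        (\<lambda>(P, Q). P \<union> Q) ` (range (left_quotient A) \<times> range (left_quotient B))" by blast
  qed
  then show ?thesis using assms by (meson finite_SigmaI finite_imageI finite_subset)
qed

lemma finitely_many_quotients_UN:
  assumes "finite I" "\<And>i. i \<in> I \<Longrightarrow> finitely_many_quotients (A i)"
  shows "finitely_many_quotients (\<Union>i\<in>I. A i)"
  using assms
proof (induction I)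
  case empty
  have "left_quotient {} = (\<lambda>_. {} :: 'b list set)" by (auto simp: left_quotient_def)
  then show ?case by simp
next
  case (insert i I)
  then show ?case using finitely_many_quotients_union[of "A i"] by simp
qed

lemma finitely_many_quotients_singleton: "finitely_many_quotients {w}"
proof -
  have "left_quotient {w} u \<in> insert {} ((\<lambda>n. {drop n w}) ` {..length w})" for u
  proof (cases "\<exists>v. u @ v = w")
    case True
    then have "left_quotient {w} u = {drop (length u) w}" "length u \<le> length w"
      by (auto simp: left_quotient_def)
    then show ?thesis by blast
  next
    case False
    then show ?thesis by (auto simp: left_quotient_def)
  qed
  then show ?thesis
    by (meson finite_imageI finite_insert finite_atMost finite_subset image_subsetI)
qed

definition language_conc :: "'a list set \<Rightarrow> 'a list set \<Rightarrow> 'a list set" (infixr "\<odot>" 75) where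
  "A \<odot> B = {u @ v |u v. u \<in> A \<and> v \<in> B}"

text \<open>After \<open>u\<close> has been read, the cut between the two factors lies either ahead,
  which leaves a quotient of \<open>A\<close> followed by \<open>B\<close>, or inside
  \<open>u\<close>, which leaves a quotient of \<open>B\<close> by a suffix of \<open>u\<close>. So
  one quotient of \<open>A\<close> and one set of quotients of \<open>B\<close> determine the
  result.\<close>

lemma finitely_many_quotients_conc:
  assumes "finitely_many_quotients A" "finitely_many_quotients B"
  shows "finitely_many_quotients (A \<odot> B)"
proof -
  have "left_quotient (A \<odot> B) u =
      left_quotient A u \<odot> B \<union> \<Union> {left_quotient B v |v. \<exists>w\<in>A. w @ v = u}" for u
  proof (intro equalityI subsetI)
    fix v assume "v \<in> left_quotient (A \<odot> B) u"
    then obtain x y where "u @ v = x @ y" and xy: "x \<in> A" "y \<in> B"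
      by (auto simp: left_quotient_def language_conc_def)
    then consider z where "x = u @ z" "v = z @ y" | z where "u = x @ z" "y = z @ v"
      by (auto simp: append_eq_append_conv2)
    then show "v \<in> left_quotient A u \<odot> B \<union> \<Union> {left_quotient B v |v. \<exists>w\<in>A. w @ v = u}"
    proof cases
      case 1
      then show ?thesis using xy unfolding left_quotient_def language_conc_def by blast
    next
      case 2
      then have "v \<in> left_quotient B z" using xy by (simp add: left_quotient_def)
      then show ?thesis using 2(1) xy(1) by blast
    qed
  next
    fix v assume "v \<in> left_quotient A u \<odot> B \<union> \<Union> {left_quotient B v |v. \<exists>w\<in>A. w @ v = u}"
    then consider x y where "v = x @ y" "u @ x \<in> A" "y \<in> B"
      | w z where "w \<in> A" "w @ z = u" "z @ v \<in> B"
      unfolding left_quotient_def language_conc_def by blast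
    then show "v \<in> left_quotient (A \<odot> B) u"
    proof cases
      case 1
      then have "u @ v = (u @ x) @ y" by simp
      then show ?thesis using 1(2,3) unfolding left_quotient_def language_conc_def by blast
    next
      case 2
      then have "u @ v = w @ (z @ v)" by auto
      then show ?thesis using 2(1,3) unfolding left_quotient_def language_conc_def by blast
    qed
  qed
  then have "left_quotient (A \<odot> B) u =
      (\<lambda>(P, Q). P \<odot> B \<union> \<Union> Q) (left_quotient A u, {left_quotient B v |v. \<exists>w\<in>A. w @ v = u})" for u
    by simp
  moreover have "(left_quotient A u, {left_quotient B v |v. \<exists>w\<in>A. w @ v = u})
      \<in> range (left_quotient A) \<times> Pow (range (left_quotient B))" for u
    by auto
  ultimately have "range (left_quotient (A \<odot> B)) \<subseteq>
      (\<lambda>(P, Q). P \<odot> B \<union> \<Union> Q) ` (range (left_quotient A) \<times> Pow (range (left_quotient B)))"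
    by (intro image_subsetI) (simp only: imageI)
  then show ?thesis using assms by (meson finite_SigmaI finite_imageI finite_Pow_iff finite_subset)
qed

definition powers_from :: "nat \<Rightarrow> 'a \<Rightarrow> 'a list set" where
  "powers_from k x = {replicate n x |n. k \<le> n}"

text \<open>Reading \<open>l\<close> copies of \<open>x\<close> lowers the threshold from
  \<open>k\<close> to \<open>k - l\<close>, truncated at 0; any other prefix leaves the empty
  language.\<close>

lemma finitely_many_quotients_powers_from: "finitely_many_quotients (powers_from k x)"
proof -
  have "left_quotient (powers_from k x) u \<in> insert {} ((\<lambda>m. powers_from m x) ` {..k})" for u
  proof (cases "set u \<subseteq> {x}")
    case True
    then obtain l where u: "u = replicate l x"
        by (metis replicate_eqI subset_singleton_iff singletonD empty_iff)
    have "v \<in> left_quotient (powers_from k x) u \<longleftrightarrow> v \<in> powers_from (k - l) x" for v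
    proof
      assume "v \<in> left_quotient (powers_from k x) u"
      then obtain n where n: "replicate l x @ v = replicate n x" "k \<le> n"
        by (auto simp: left_quotient_def powers_from_def u)
      then have "v = replicate (n - l) x" by (metis append_eq_conv_conj drop_replicate
          length_replicate)
      moreover have "k - l \<le> n - l" using n(2) by simp
      ultimately show "v \<in> powers_from (k - l) x" unfolding powers_from_def by blast
    next
      assume "v \<in> powers_from (k - l) x"
      then obtain n where "v = replicate n x" "k - l \<le> n" by (auto simp: powers_from_def)
      then show "v \<in> left_quotient (powers_from k x) u"
        by (auto simp: left_quotient_def powers_from_def u replicate_add[symmetric]
            intro!: exI[of _ "l + n"])
    qed
    then have "left_quotient (powers_from k x) u = powers_from (k - l) x" by blast
    then show ?thesis by auto
  next
    case False
    have "set u \<subseteq> {x}" if "u @ v = replicate n x" for v n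
    proof -
      have "set (u @ v) \<subseteq> {x}" unfolding that by auto
      then show ?thesis by simp
    qed
    with False have "left_quotient (powers_from k x) u = {}"
      by (auto simp: left_quotient_def powers_from_def)
    then show ?thesis by simp
  qed
  then show ?thesis
    by (meson finite_imageI finite_insert finite_atMost finite_subset image_subsetI)
qed

text \<open>Here \<open>\<sigma> u\<close> stands for the state reached after \<open>u\<close>.
  Instead of a transition function it suffices that prefixes with the same state are
  interchangeable.\<close>

lemma finitely_many_quotients_state:
  assumes "finite (range \<sigma>)" and "\<And>u v w. \<sigma> u = \<sigma> v \<Longrightarrow> u @ w \<in> L \<Longrightarrow> v @ w \<in> L"
  shows "finitely_many_quotients L"
proof -
  have "left_quotient L u = left_quotient L (SOME v. \<sigma> v = \<sigma> u)" for u
    using assms(2)[of u "SOME v. \<sigma> v = \<sigma> u"] assms(2)[of "SOME v. \<sigma> v = \<sigma> u" u]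
      someI[of "\<lambda>v. \<sigma> v = \<sigma> u" u] by (auto simp: left_quotient_def)
  then have "range (left_quotient L) \<subseteq> (\<lambda>s. left_quotient L (SOME v. \<sigma> v = s)) ` range \<sigma>" by blast
  then show ?thesis using assms(1) by (meson finite_imageI finite_subset)
qed

section \<open>A criterion for non-regularity\<close>

lemma not_regular_if_compares_blocks:
  assumes "x \<in> X" "y \<in> X"
    and mem: "\<And>i j. i + 2 \<le> j \<Longrightarrow> replicate i x @ [y] @ replicate j x @ [y] \<in> L"
    and nonmem: "\<And>i j. j \<le> i \<Longrightarrow> replicate i x @ [y] @ replicate j x @ [y] \<notin> L"
  shows "\<not> regular_language X L"
proof
  assume "regular_language X L"
  then obtain Q :: "nat set" and \<delta> q0 F where Q: "finite Q" "q0 \<in> Q"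
    "\<forall>q\<in>Q. \<forall>x\<in>X. \<delta> q x \<in> Q" and L: "L = {w \<in> lists X. foldl \<delta> q0 w \<in> F}"
    unfolding regular_language_def by blast
  have run: "foldl \<delta> q w \<in> Q" if "q \<in> Q" "w \<in> lists X" for q w
    using that Q(3) by (induction w arbitrary: q) auto
  \<comment> \<open>Doubled exponents avoid the undecided words whose second exponent exceeds the
    first by 1: for \<open>i < j\<close> the tail exponent \<open>2 * i + 2\<close> is large enough
    after \<open>2 * i\<close> letters \<open>x\<close>, and at most \<open>2 * j\<close>.\<close>
  define st where "st i = foldl \<delta> q0 (replicate (2 * i) x @ [y])" for i
  have "replicate n x @ [y] \<in> lists X" for n using assms(1,2) by auto
  then have "range st \<subseteq> Q" unfolding st_def using run[OF Q(2)] by blast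
  then have "\<not> inj st" using Q(1) by (meson finite_subset infinite_UNIV_nat finite_imageD)
  then obtain i j where ij: "st i = st j" "i < j" unfolding inj_def by (metis linorder_neqE_nat)
  let ?tail = "replicate (2 * i + 2) x @ [y]"
  have "foldl \<delta> q0 ((replicate (2 * i) x @ [y]) @ ?tail) \<in> F"
    using mem[of "2 * i" "2 * i + 2"] by (simp add: L)
  then have "foldl \<delta> q0 ((replicate (2 * j) x @ [y]) @ ?tail) \<in> F"
    using ij(1) unfolding st_def foldl_append by simp
  moreover have "(replicate (2 * j) x @ [y]) @ ?tail \<in> lists X" using assms(1,2) by auto
  ultimately have "replicate (2 * j) x @ [y] @ replicate (2 * i + 2) x @ [y] \<in> L"
    by (simp add: L)
  then show False using nonmem[of "2 * i + 2" "2 * j"] ij(2) by simp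
qed

section \<open>Words over the seven letters and their lengths\<close>

datatype letter = La bool | Lc bool | Ld bool | Lt

type_synonym elt = "(int \<times> int) \<times> int"

abbreviation sg :: "bool \<Rightarrow> int" where "sg s \<equiv> (if s then 1 else - 1)"

text \<open>Left multiplication by a generator in the semidirect product, so that
  \<open>foldr\<close> evaluates a word; on \<open>{0, 1}\<close> the term \<open>1 - k\<close> is
  addition of 1 modulo 2.\<close>

fun act :: "letter \<Rightarrow> elt \<Rightarrow> elt" where
  "act (La s) ((i, j), k) = ((i + sg s, j), k)"
| "act (Lc s) ((i, j), k) = ((i + 2 * sg s, j), k)"
| "act (Ld s) ((i, j), k) = ((i + sg s, j + sg s), k)"
| "act Lt ((i, j), k) = ((j, i), 1 - k)"

definition val :: "letter list \<Rightarrow> elt" where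
  "val w = foldr act w ((0, 0), 0)"

text \<open>The least number of letters a and c, with signs, whose displacements add up to
  \<open>n\<close>.\<close>

definition half :: "int \<Rightarrow> int" where
  "half n = (\<bar>n\<bar> + 1) div 2"

text \<open>The least number of letters other than \<open>t\<close> with total displacement \<open>(i, j)\<close> when each
  letter may be placed on either side of a \<open>t\<close>.\<close>

definition spread :: "int \<Rightarrow> int \<Rightarrow> int" where
  "spread i j = (if 0 \<le> i * j then half (i + j) else half i + half j)"

text \<open>For \<open>k = 0\<close> the two bounds belong to words without \<open>t\<close> and to words with at least two
  letters \<open>t\<close>.\<close>

fun elt_len :: "elt \<Rightarrow> int" where
  "elt_len ((i, j), k) =
    (if k = 0 then min (\<bar>j\<bar> + half (i - j)) (2 + spread i j) else 1 + spread i j)"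

text \<open>Conjugation exchanges the coordinates \<open>(i, j)\<close> of an element with \<open>k = 0\<close>; if
  \<open>k = 1\<close>, then the conjugacy class consists of all elements with the same \<open>k\<close> and \<open>i + j\<close>.\<close>

fun conj_len :: "elt \<Rightarrow> int" where
  "conj_len ((i, j), k) =
    (if k \<noteq> 0 then 1 + half (i + j)
     else if 0 \<le> i * j then half (i + j)
     else min (min \<bar>i\<bar> \<bar>j\<bar> + half (\<bar>i\<bar> + \<bar>j\<bar>)) (2 + half i + half j))"

lemma half_bounds: "\<bar>n\<bar> \<le> 2 * half n" "2 * half n \<le> \<bar>n\<bar> + 1"
  by (auto simp: half_def)

lemma zero_le_mult_int_iff:
  fixes i j :: int
  shows "0 \<le> i * j \<longleftrightarrow> (0 \<le> i \<and> 0 \<le> j) \<or> (i \<le> 0 \<and> j \<le> 0)"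
  by (simp add: zero_le_mult_iff)

lemma half_step: "\<bar>m - n\<bar> \<le> 2 \<Longrightarrow> half m \<le> half n + 1"
  unfolding half_def by presburger

lemma spread_swap: "spread i j = spread j i"
  by (simp add: spread_def ac_simps)

text \<open>Letters that may choose their side of a t never need to be more numerous than in a word
  without t. This covers the first t of a word in \<open>elt_len_act\<close>.\<close>

lemma spread_le: "spread i j \<le> \<bar>j\<bar> + half (i - j)"
  using half_bounds[of i] half_bounds[of j] half_bounds[of "i - j"] half_bounds[of "i + j"]
  unfolding spread_def zero_le_mult_int_iff by (auto simp: abs_if split: if_splits)

lemma spread_step: "e \<in> {1, -1, 2, -2} \<Longrightarrow> spread (i + e) j \<le> spread i j + 1"
  using half_bounds[of i] half_bounds[of j] half_bounds[of "i + j"]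
    half_bounds[of "i + e"] half_bounds[of "i + e + j"]
  unfolding spread_def zero_le_mult_int_iff insert_iff empty_iff by (elim disjE) (smt (z3))+

lemma spread_step_diag: "e = 1 \<or> e = -1 \<Longrightarrow> spread (i + e) (j + e) \<le> spread i j + 1"
  using half_bounds[of i] half_bounds[of j] half_bounds[of "i + j"]
    half_bounds[of "i + e"] half_bounds[of "j + e"] half_bounds[of "i + e + (j + e)"]
  unfolding spread_def zero_le_mult_int_iff by (smt (z3))

text \<open>A letter other than t raises each of the competing bounds by at most 1. A letter t
  exchanges the coordinates, to which \<open>spread\<close> is indifferent, and passes between the
  constants 1 and 2; from the bound for words without t, \<open>spread_le\<close> leads to the value
  for \<open>k = 1\<close>.\<close>

lemma elt_len_act:
  assumes "snd g \<in> {0, 1}"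
  shows "elt_len (act x g) \<le> elt_len g + 1"
proof -
  obtain i j k where g: "g = ((i, j), k)" by (cases g) auto
  show ?thesis
  proof (cases x)
    case (La s)
    have "half (i + sg s - j) \<le> half (i - j) + 1" by (rule half_step) simp
    moreover have "spread (i + sg s) j \<le> spread i j + 1" by (rule spread_step) simp
    ultimately show ?thesis by (auto simp: g La)
  next
    case (Lc s)
    have "half (i + 2 * sg s - j) \<le> half (i - j) + 1" by (rule half_step) simp
    moreover have "spread (i + 2 * sg s) j \<le> spread i j + 1" by (rule spread_step) simp
    ultimately show ?thesis by (auto simp: g Lc)
  next
    case (Ld s)
    have "spread (i + sg s) (j + sg s) \<le> spread i j + 1" by (rule spread_step_diag) simp
    then show ?thesis by (auto simp: g Ld)
  next
    case Lt
    then show ?thesis using assms spread_swap[of i j] spread_le[of i j] by (auto simp: g)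
  qed
qed

lemma snd_act: "snd g \<in> {0, 1} \<Longrightarrow> snd (act x g) \<in> {0, 1}"
  by (cases g; cases "fst g"; cases x) auto

lemma val_Nil [simp]: "val [] = ((0, 0), 0)" and val_Cons [simp]: "val (x # w) = act x (val w)"
  by (simp_all add: val_def)

lemma snd_val: "snd (val w) \<in> {0, 1}"
  by (induction w) (use snd_act in auto)

lemma elt_len_val_le: "elt_len (val w) \<le> int (length w)"
proof (induction w)
  case Nil
  then show ?case by (simp add: half_def spread_def)
next
  case (Cons x w)
  then show ?case using elt_len_act[OF snd_val, of x w] by simp
qed

lemma half_add_le: "half (i + j) \<le> half i + half j"
  using half_bounds[of i] half_bounds[of j] half_bounds[of "i + j"] by linarith

text \<open>For coordinates of opposite sign |i - j| = |i| + |j|, so the bound for words without t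
  depends on the order of the coordinates only through the summand |j|; this explains the minimum of
  |i| and |j| in \<open>conj_len\<close>.\<close>

lemma conj_len_le_elt_len: "conj_len ((i, j), k) \<le> elt_len ((i, j), k)"
proof (cases "0 \<le> i * j")
  case True
  then show ?thesis using spread_le[of i j] half_add_le[of i j] by (auto simp: spread_def)
next
  case False
  then have "\<bar>i - j\<bar> = \<bar>i\<bar> + \<bar>j\<bar>" by (auto simp: zero_le_mult_int_iff)
  then have "half (i - j) = half (\<bar>i\<bar> + \<bar>j\<bar>)" by (simp add: half_def)
  with False show ?thesis using half_add_le[of i j] by (auto simp: spread_def min_le_iff_disj)
qed

lemma conj_len_val_le: "conj_len (val w) \<le> int (length w)"
  using conj_len_le_elt_len elt_len_val_le[of w] order_trans by (metis prod.collapse)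

section \<open>Conjugacy geodesics\<close>

text \<open>Occurrences of \<open>x\<close> after an even (\<open>p = True\<close>) or odd (\<open>p = False\<close>) number of letters
  \<open>t\<close>: the former displace the first coordinate, the latter the second one.\<close>

fun seg_count :: "bool \<Rightarrow> letter \<Rightarrow> letter list \<Rightarrow> nat" where
  "seg_count p x [] = 0"
| "seg_count p x (y # w) =
    (if y = Lt then seg_count (\<not> p) x w else (if p \<and> y = x then 1 else 0) + seg_count p x w)"

lemma seg_count_sum: "x \<noteq> Lt \<Longrightarrow> seg_count True x w + seg_count False x w = count_list w x"
proof -
  have "seg_count p x w + seg_count (\<not> p) x w = count_list w x" if "x \<noteq> Lt" for p
    using that
  proof (induction w arbitrary: p)
    case (Cons y w)
    then show ?case using Cons.IH[of "\<not> p"] by (cases p) auto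
  qed simp
  from this[of True] show "x \<noteq> Lt \<Longrightarrow> ?thesis" by simp
qed

lemma seg_count_False_0: "count_list w Lt = 0 \<Longrightarrow> seg_count False x w = 0"
  by (induction w) (auto split: if_splits)

text \<open>A displacement measured in the direction \<open>s\<close>. With the sign as a parameter,
  the case analyses below may assume a convenient orientation. Letters d displace both coordinates
  and are counted whatever \<open>p\<close> is.\<close>

definition coord :: "bool \<Rightarrow> bool \<Rightarrow> letter list \<Rightarrow> int" where
  "coord s p w = 2 * int (seg_count p (Lc s) w) - 2 * int (seg_count p (Lc (\<not> s)) w)
    + int (seg_count p (La s) w) - int (seg_count p (La (\<not> s)) w)
    + int (count_list w (Ld s)) - int (count_list w (Ld (\<not> s)))"

lemma val_eq_coord:
  "val w = ((sg s * coord s True w, sg s * coord s False w), int (count_list w Lt) mod 2)"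
proof (induction w)
  case Nil
  then show ?case by (simp add: coord_def)
next
  case (Cons x w)
  have "(1 - int n mod 2) = (int n + 1) mod 2" for n by presburger
  then show ?case by (cases x) (auto simp: Cons coord_def algebra_simps)
qed

lemma length_eq_seg_count:
  "int (length w) = int (count_list w Lt) + int (count_list w (Ld s)) +
      int (count_list w (Ld (\<not> s)))
    + int (seg_count True (La s) w) + int (seg_count True (La (\<not> s)) w) +
        int (seg_count True (Lc s) w)
    + int (seg_count True (Lc (\<not> s)) w) + int (seg_count False (La s) w) +
        int (seg_count False (La (\<not> s)) w)
    + int (seg_count False (Lc s) w) + int (seg_count False (Lc (\<not> s)) w)"
proof (induction w)
  case (Cons x w)
  then show ?case by (cases x) (auto simp: algebra_simps)
qed simp

lemma half_minus [simp]: "half (- n) = half n"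
  by (simp add: half_def)

lemma half_nonneg_iff: "0 \<le> n \<Longrightarrow> l = half n \<longleftrightarrow> n \<le> 2 * l \<and> 2 * l \<le> n + 1"
  unfolding half_def by auto

lemma conj_len_sg: "conj_len ((sg s * i, sg s * j), k) = conj_len ((i, j), k)"
proof (cases s)
  case False
  have "half (- i - j) = half (i + j)" using half_minus[of "i + j"] by simp
  with False show ?thesis by simp
qed simp

text \<open>In each of the four cases, twice the length exceeds \<open>\<bar>i\<bar> + \<bar>j\<bar>\<close> (or \<open>\<bar>i + j\<bar>\<close>) by a sum
  of nonnegative weights of letters. For a conjugacy geodesic this defect is bounded, so only
  letters of weight 0 can occur often.\<close>

definition conj_geo_even :: "bool \<Rightarrow> letter list \<Rightarrow> bool" where
  "conj_geo_even s w \<longleftrightarrow> count_list w Lt = 0 \<and> count_list w (La (\<not> s)) = 0 \<and>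
    count_list w (Lc (\<not> s)) = 0 \<and> count_list w (Ld (\<not> s)) = 0 \<and> count_list w (La s) \<le> 1"

text \<open>Up to the order of letters these are the words c^p a^a d^{-m} and their inverses. The
  bound m <= p says that the coordinate -m is not the larger one in absolute value. From m = 4 on,
  or for m = 3 and a = 1, two letters t and fewer letters d give a smaller bound.\<close>

definition conj_geo_mixed :: "bool \<Rightarrow> letter list \<Rightarrow> bool" where
  "conj_geo_mixed s w \<longleftrightarrow> count_list w Lt = 0 \<and> count_list w (La (\<not> s)) = 0 \<and>
    count_list w (Lc (\<not> s)) = 0 \<and> count_list w (Ld s) = 0 \<and> count_list w (La s) \<le> 1 \<and>
    1 \<le> count_list w (Ld (\<not> s)) \<and> count_list w (Ld (\<not> s)) \<le> 3 \<and>
    (count_list w (Ld (\<not> s)) = 3 \<longrightarrow> count_list w (La s) = 0) \<and>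
    count_list w (Ld (\<not> s)) \<le> count_list w (Lc s)"

definition conj_geo_odd :: "bool \<Rightarrow> letter list \<Rightarrow> bool" where
  "conj_geo_odd s w \<longleftrightarrow> count_list w Lt = 1 \<and> count_list w (La (\<not> s)) = 0 \<and>
    count_list w (Lc (\<not> s)) = 0 \<and> count_list w (Ld (\<not> s)) = 0 \<and> count_list w (La s) \<le> 1"

text \<open>The two lower bounds on the number of letters c come from the comparison with words
  without t. A letter d has weight 2 but changes the parity of both coordinates, so one d is as
  affordable as one a on each side of t, and no more than that is.\<close>

definition conj_geo_twist :: "bool \<Rightarrow> letter list \<Rightarrow> bool" where
  "conj_geo_twist s w \<longleftrightarrow> count_list w Lt = 2 \<and> seg_count True (La (\<not> s)) w = 0 \<and>
    seg_count True (Lc (\<not> s)) w = 0 \<and> seg_count False (La s) w = 0 \<and> seg_count False (Lc s) w = 0 \<and>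
    1 + count_list w (Ld (\<not> s)) \<le> seg_count True (Lc s) w \<and>
    1 + count_list w (Ld s) \<le> seg_count False (Lc (\<not> s)) w \<and>
    (count_list w (Ld s) + count_list w (Ld (\<not> s)) = 0 \<and>
       seg_count True (La s) w \<le> 1 \<and> seg_count False (La (\<not> s)) w \<le> 1 \<or>
     count_list w (Ld s) + count_list w (Ld (\<not> s)) = 1 \<and>
       seg_count True (La s) w = 0 \<and> seg_count False (La (\<not> s)) w = 0)"

definition conj_geo :: "letter list \<Rightarrow> bool" where
  "conj_geo w \<longleftrightarrow> (\<exists>s. conj_geo_even s w \<or> conj_geo_mixed s w \<or> conj_geo_odd s w \<or>
      conj_geo_twist s w)"

section \<open>Conjugacy geodesics are exactly the words of the four patterns\<close>

lemma conj_len_coord: "conj_len (val w) = conj_len ((coord s True w, coord s False w), int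
    (count_list w Lt) mod 2)"
  by (subst val_eq_coord[of w s]) (rule conj_len_sg)

lemma conj_geo_odd_if:
  assumes "odd (count_list w Lt)" "0 \<le> coord s True w + coord s False w"
      "int (length w) = conj_len (val w)"
  shows "conj_geo_odd s w"
proof -
  have "int (count_list w Lt) mod 2 = 1" using assms(1) by presburger
  then have "int (length w) = 1 + half (coord s True w + coord s False w)"
      using assms(3) conj_len_coord[of w s] by simp
  moreover have "count_list w Lt \<ge> 1" using assms(1) by (cases "count_list w Lt") auto
  ultimately show ?thesis
    using half_bounds(2)[of "coord s True w + coord s False w"] assms(2)
        seg_count_sum[of "La s" w] seg_count_sum[of "La (\<not> s)" w]
      seg_count_sum[of "Lc (\<not> s)" w] seg_count_sum[of "Lc s" w] length_eq_seg_count[of w s]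
    unfolding conj_geo_odd_def coord_def by (intro conjI; simp; linarith)
qed

lemma conj_geo_even_if:
  assumes "even (count_list w Lt)" "0 \<le> coord s True w * coord s False w"
      "0 \<le> coord s True w + coord s False w" "int (length w) = conj_len (val w)"
  shows "conj_geo_even s w"
proof -
  have "int (count_list w Lt) mod 2 = 0" using assms(1) by presburger
  then have "int (length w) = half (coord s True w + coord s False w)"
      using assms(2,4) conj_len_coord[of w s] by simp
  then have "2 * count_list w Lt \<le> 1 \<and> count_list w (La (\<not> s)) = 0 \<and>
    count_list w (Lc (\<not> s)) = 0 \<and> count_list w (Ld (\<not> s)) = 0 \<and> count_list w (La s) \<le> 1"
    using half_bounds(2)[of "coord s True w + coord s False w"] assms(3)
        seg_count_sum[of "La s" w] seg_count_sum[of "La (\<not> s)" w]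
      seg_count_sum[of "Lc (\<not> s)" w] seg_count_sum[of "Lc s" w] length_eq_seg_count[of w s]
    unfolding coord_def by (intro conjI; simp; linarith)
  then show ?thesis unfolding conj_geo_even_def by simp
qed

lemma conj_geo_twist_or_mixed_if:
  assumes ev: "even (count_list w Lt)" and ij: "0 < coord s True w" "coord s False w < 0"
      and len: "int (length w) = conj_len (val w)"
  shows "conj_geo_twist s w \<or> conj_geo_mixed s w"
proof -
  have "int (count_list w Lt) mod 2 = 0" using ev by presburger
  moreover have "\<not> 0 \<le> coord s True w * coord s False w" using ij
      by (simp add: zero_le_mult_int_iff)
  ultimately have le1: "int (length w) \<le> coord s True w +
      half (\<bar>coord s True w\<bar> + \<bar>coord s False w\<bar>)"
      "int (length w) \<le> - coord s False w + half (\<bar>coord s True w\<bar> + \<bar>coord s False w\<bar>)"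
    and le2: "int (length w) \<le> 2 + half (coord s True w) + half (coord s False w)"
    using len conj_len_coord[of w s] ij by auto
  have le3: "2 * int (length w) \<le> 3 * coord s True w - coord s False w + 1"
      "2 * int (length w) \<le> coord s True w - 3 * coord s False w + 1"
    using le1 half_bounds(2)[of "\<bar>coord s True w\<bar> + \<bar>coord s False w\<bar>"] ij by linarith+
  have halves: "2 * half (coord s True w) = coord s True w + coord s True w mod 2"
      "2 * half (coord s False w) = - coord s False w + coord s False w mod 2"
    using ij unfolding half_def by presburger+
  have le4: "2 * int (length w) \<le> 4 + coord s True w - coord s False w + coord s True w mod 2 +
      coord s False w mod 2"
    using le2 halves by linarith
  define e where "e = int (count_list w (Ld s)) + int (count_list w (Ld (\<not> s)))"
  have mods: "coord s True w mod 2 = (int (seg_count True (La s) w) +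
      int (seg_count True (La (\<not> s)) w) + e) mod 2"
    "coord s False w mod 2 = (int (seg_count False (La s) w) +
        int (seg_count False (La (\<not> s)) w) + e) mod 2"
    unfolding coord_def e_def by presburger+
  \<comment> \<open>The weights refer to the difference of the coordinates: a letter c in the
    favourable direction contributes 2 to it and has weight 0, a letter d leaves it unchanged and
    has weight 2. The constant 4 is twice the summand 2 in \<open>le2\<close>.\<close>
  have defect: "2 * int (count_list w Lt) + 2 * e + int (seg_count True (La s) w) +
      3 * int (seg_count True (La (\<not> s)) w)
      + 4 * int (seg_count True (Lc (\<not> s)) w) + 3 * int (seg_count False (La s) w) +
          int (seg_count False (La (\<not> s)) w)
      + 4 * int (seg_count False (Lc s) w) \<le> 4 + coord s True w mod 2 + coord s False w mod 2"
    using le4 length_eq_seg_count[of w s] coord_def[of s True w] coord_def[of s False w] e_def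
        by linarith
  obtain x y where xy: "coord s True w mod 2 = x" "coord s False w mod 2 = y" "x \<le> 1" "y \<le> 1"
      by auto
  have "2 * int (count_list w Lt) \<le> 6" using defect[unfolded xy(1,2)] xy(3,4) unfolding e_def
      by auto
  then have "count_list w Lt \<le> 3" by simp
  with ev consider "count_list w Lt = 0" | "count_list w Lt = 2"
    by (metis One_nat_def Suc_1 even_Suc le_SucE le_zero_eq numeral_3_eq_3 odd_one)
  then show ?thesis
  proof cases
    case 1
    note [simp] = seg_count_False_0[OF this]
    have sums: "count_list w x = seg_count True x w" if "x \<noteq> Lt" for x
        using seg_count_sum[OF that, of w] by simp
    have "int (count_list w (Ld s)) = 0 \<and> int (seg_count True (La (\<not> s)) w) = 0 \<and>
        int (seg_count True (Lc (\<not> s)) w) = 0 \<and> int (seg_count True (La s) w) \<le> 1"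
      using le3(2) length_eq_seg_count[of w s] 1 unfolding coord_def by auto
    then have z: "count_list w (Ld s) = 0" "seg_count True (La (\<not> s)) w = 0"
        "seg_count True (Lc (\<not> s)) w = 0" "seg_count True (La s) w \<le> 1" by auto
    have D: "1 \<le> count_list w (Ld (\<not> s))" using ij(2) z unfolding coord_def by simp
    have "count_list w (Ld (\<not> s)) \<le> 3" using defect z 1 unfolding e_def by auto
    moreover have "count_list w (Ld (\<not> s)) = 3 \<longrightarrow> seg_count True (La s) w = 0"
      using defect z 1 mods unfolding e_def by auto
    moreover have "count_list w (Ld (\<not> s)) \<le> seg_count True (Lc s) w"
      using le3(1) z 1 length_eq_seg_count[of w s] unfolding coord_def by auto
    ultimately have "conj_geo_mixed s w" unfolding conj_geo_mixed_def using z D 1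
        by (simp add: sums)
    then show ?thesis ..
  next
    case 2
    have z: "seg_count True (La (\<not> s)) w = 0" "seg_count True (Lc (\<not> s)) w = 0"
      "seg_count False (La s) w = 0" "seg_count False (Lc s) w = 0" "e \<le> 1"
          "seg_count True (La s) w \<le> 2" "seg_count False (La (\<not> s)) w \<le> 2"
      using defect 2 unfolding e_def by auto
    \<comment> \<open>Two letters t use up the constant 4, so the remaining weights are bounded by
      the two parities alone.\<close>
    have "int (seg_count True (La s) w) + int (seg_count False (La (\<not> s)) w) + 2 * e \<le>
        (int (seg_count True (La s) w) + e) mod 2 + (int (seg_count False (La (\<not> s)) w) + e) mod 2"
      using defect 2 mods z by simp
    moreover have "e = 0 \<or> e = 1" using z(5) unfolding e_def by linarith
    moreover have "x = 0 \<or> x = 1 \<or> x = 2" if "x \<le> 2" for x :: nat using that by auto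
    ultimately have par: "e = 0 \<and> seg_count True (La s) w \<le> 1 \<and> seg_count False (La (\<not> s)) w \<le> 1 \<or>
      e = 1 \<and> seg_count True (La s) w = 0 \<and> seg_count False (La (\<not> s)) w = 0"
      using z(6,7) by fastforce
    have "3 + int (seg_count False (La (\<not> s)) w) + 2 * e \<le> 4 * int (seg_count True (Lc s) w)
        + int (seg_count True (La s) w) + 2 * int (count_list w (Ld s)) -
            2 * int (count_list w (Ld (\<not> s)))"
      "3 + int (seg_count True (La s) w) + 2 * e \<le> 4 * int (seg_count False (Lc (\<not> s)) w)
        + int (seg_count False (La (\<not> s)) w) - 2 * int (count_list w (Ld s)) +
            2 * int (count_list w (Ld (\<not> s)))"
      using le3 z(1-4) 2 length_eq_seg_count[of w s] coord_def[of s True w]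
          coord_def[of s False w] e_def
      by auto
    then have "1 + count_list w (Ld (\<not> s)) \<le> seg_count True (Lc s) w"
      "1 + count_list w (Ld s) \<le> seg_count False (Lc (\<not> s)) w"
      using par unfolding e_def by auto
    then have "conj_geo_twist s w" unfolding conj_geo_twist_def using z par 2 unfolding e_def
        by auto
    then show ?thesis ..
  qed
qed

lemma conj_len_if_conj_geo_odd: "conj_geo_odd s w \<Longrightarrow> int (length w) = conj_len (val w)"
  using half_nonneg_iff[of "coord s True w + coord s False w" "int (length w) - 1"]
     seg_count_sum[of "La s" w] seg_count_sum[of "La (\<not> s)" w]
      seg_count_sum[of "Lc (\<not> s)" w] seg_count_sum[of "Lc s" w]
  unfolding conj_len_coord[of w s] conj_geo_odd_def length_eq_seg_count[of w s] coord_def by auto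

lemma conj_len_if_conj_geo_even: "conj_geo_even s w \<Longrightarrow> int (length w) = conj_len (val w)"
  using half_nonneg_iff[of "coord s True w + coord s False w" "int (length w)"]
      seg_count_False_0[of w]
     seg_count_sum[of "La s" w] seg_count_sum[of "La (\<not> s)" w]
      seg_count_sum[of "Lc (\<not> s)" w] seg_count_sum[of "Lc s" w]
  unfolding conj_len_coord[of w s] conj_geo_even_def length_eq_seg_count[of w s] coord_def by auto

lemma conj_len_if_conj_geo_mixed: assumes "conj_geo_mixed s w"
    shows "int (length w) = conj_len (val w)"
proof -
  define p m a where "p = int (seg_count True (Lc s) w)" "m = int (count_list w (Ld (\<not> s)))"
    "a = int (seg_count True (La s) w)"
  have 0: "count_list w Lt = 0" using assms by (simp add: conj_geo_mixed_def)
  have ij: "coord s True w = 2 * p + a - m" "coord s False w = - m" "int (length w) = p + a + m"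
      "a = 0 \<or> a = 1" "m \<le> p"
    "m = 1 \<or> m = 2 \<or> m = 3 \<and> a = 0"
    using assms seg_count_False_0[OF 0] seg_count_sum[of "La s" w] seg_count_sum[of "La (\<not> s)" w]
      seg_count_sum[of "Lc (\<not> s)" w] seg_count_sum[of "Lc s" w]
    unfolding conj_geo_mixed_def coord_def length_eq_seg_count[of w s] p_m_a_def by auto
  have pos: "0 < coord s True w" "coord s False w < 0" using ij by auto
  have "half (\<bar>coord s True w\<bar> + \<bar>coord s False w\<bar>) = p + a" using ij pos unfolding half_def by auto
  moreover have "p + a + m \<le> 2 + half (coord s True w) + half (coord s False w)"
    using ij pos unfolding half_def by auto
  ultimately show ?thesis
    using 0 ij pos unfolding conj_len_coord[of w s] conj_len.simps zero_le_mult_int_iff by auto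
qed

lemma conj_len_if_conj_geo_twist: assumes "conj_geo_twist s w"
    shows "int (length w) = conj_len (val w)"
proof -
  define p q a b d d' where "p = int (seg_count True (Lc s) w)"
      "q = int (seg_count False (Lc (\<not> s)) w)"
    "a = int (seg_count True (La s) w)" "b = int (seg_count False (La (\<not> s)) w)"
    "d = int (count_list w (Ld s))" "d' = int (count_list w (Ld (\<not> s)))"
  have ij: "coord s True w = 2 * p + a + d - d'" "coord s False w = - 2 * q - b + d - d'"
      "int (length w) = 2 + p + q + a + b + d + d'"
    "1 + d' \<le> p" "1 + d \<le> q" "int (count_list w Lt) mod 2 = 0"
        "d = 0 \<and> d' = 0 \<and> (a = 0 \<or> a = 1) \<and> (b = 0 \<or> b = 1) \<or> (d = 1 \<and> d' = 0 \<or> d = 0 \<and> d' = 1) \<and>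
        a = 0 \<and> b = 0"
    using assms
    unfolding conj_geo_twist_def coord_def length_eq_seg_count[of w s] p_q_a_b_d_d'_def by auto
  have pos: "0 < coord s True w" "coord s False w < 0" using ij by auto
  have "half (coord s True w) = p + a + d" "half (coord s False w) = q + b + d'"
    using ij pos unfolding half_def by auto
  moreover have "2 + p + q + a + b + d + d' \<le> min (coord s True w) (- coord s False w) +
      half (coord s True w - coord s False w)"
    using ij half_bounds(1)[of "coord s True w - coord s False w"] by auto
  ultimately show ?thesis
    using ij pos unfolding conj_len_coord[of w s] conj_len.simps zero_le_mult_int_iff by auto
qed

lemma coord_neg: "coord (\<not> s) p w = - coord s p w"
  by (simp add: coord_def)

theorem conj_len_eq_iff_conj_geo: "int (length w) = conj_len (val w) \<longleftrightarrow> conj_geo w"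
proof
  assume len: "int (length w) = conj_len (val w)"
  have "0 \<le> coord True True w + coord True False w \<or> 0 \<le> coord False True w + coord False False w"
    using coord_neg[of True True w] coord_neg[of True False w] by auto
  then obtain s where s: "0 \<le> coord s True w + coord s False w" by blast
  show "conj_geo w"
  proof (cases "odd (count_list w Lt)")
    case True
    then show ?thesis using conj_geo_odd_if[OF True s len] by (auto simp: conj_geo_def)
  next
    case ev: False
    show ?thesis
    proof (cases "0 \<le> coord s True w * coord s False w")
      case True
      then show ?thesis using conj_geo_even_if ev s len by (auto simp: conj_geo_def)
    next
      case False
      \<comment> \<open>For coordinates of opposite sign the direction is chosen anew, so that the
        first one becomes positive.\<close>
      then consider "0 < coord s True w" "coord s False w < 0" | "0 < coord (\<not> s) True w"
          "coord (\<not> s) False w < 0"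
        unfolding coord_neg zero_le_mult_int_iff by linarith
      then show ?thesis using conj_geo_twist_or_mixed_if ev len by cases (auto simp: conj_geo_def)
    qed
  qed
qed (auto simp: conj_geo_def conj_len_if_conj_geo_odd conj_len_if_conj_geo_even
    conj_len_if_conj_geo_mixed conj_len_if_conj_geo_twist)

section \<open>The shortlex order\<close>

text \<open>As \<open>t\<close> is the greatest letter, a shortlex least word ends with its second \<open>t\<close>; as \<open>c\<close> is
  the least one, \<open>c\<^sup>i t c\<^sup>j t\<close> is shortlex least whenever \<open>i + 2 \<le> j\<close>.\<close>

fun rank :: "letter \<Rightarrow> nat" where
  "rank (Lc s) = (if s then 0 else 1)"
| "rank (La s) = (if s then 2 else 3)"
| "rank (Ld s) = (if s then 4 else 5)"
| "rank Lt = 6"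

lemma rank_inject [simp]: "rank x = rank y \<longleftrightarrow> x = y"
  by (cases x; cases y) auto

definition letter_order :: "letter rel" where
  "letter_order = {(x, y). rank x \<le> rank y}"

lemma strict_letter_order: "letter_order - Id = measure rank"
  by (auto simp: letter_order_def order_less_le)

definition least_in :: "letter list set \<Rightarrow> letter list \<Rightarrow> bool" where
  "least_in W w \<longleftrightarrow> w \<in> W \<and> (\<forall>v\<in>W. shortlex_le letter_order w v)"

lemma shortlex_le_iff: "shortlex_le letter_order u v \<longleftrightarrow> (v, u) \<notin> lenlex (measure rank)"
proof -
  have "total (measure rank)" by (auto simp: total_on_def) (metis linorder_neqE_nat rank_inject)
  then have "total (lenlex (measure rank))" by (rule total_lenlex)
  moreover have "asym (lenlex (measure rank))" by (intro asym_lenlex asymI) auto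
  ultimately show ?thesis
    unfolding shortlex_le_def strict_letter_order by (metis UNIV_I asymD total_on_def)
qed

lemma ex_least_in: "W \<noteq> {} \<Longrightarrow> \<exists>w. least_in W w"
  unfolding least_in_def shortlex_le_iff
  using wf_lenlex[OF wf_measure[of rank]] by (metis ex_in_conv wfE_min)

lemma least_in_unique:
  assumes "least_in W u" "least_in W v"
  shows "u = v"
proof -
  have "shortlex_le letter_order u v" "shortlex_le letter_order v u"
    using assms by (auto simp: least_in_def)
  then show ?thesis
    unfolding shortlex_le_iff[of v u] by (simp add: shortlex_le_def strict_letter_order)
qed

lemma length_le_if_least_in: "least_in W w \<Longrightarrow> v \<in> W \<Longrightarrow> length w \<le> length v"
  unfolding least_in_def shortlex_le_iff by (auto simp: lenlex_conv not_less[symmetric])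

lemma not_least_in:
  assumes "p @ y # v \<in> W" "rank y < rank x" "length v = length u"
  shows "\<not> least_in W (p @ x # u)"
proof
  assume "least_in W (p @ x # u)"
  then have "(p @ y # v, p @ x # u) \<notin> lenlex (measure rank)"
    using assms(1) unfolding least_in_def shortlex_le_iff by blast
  then show False using assms(2,3) by (simp add: Cons_lenlex_iff irrefl_def)
qed

lemma val_append: "val (u @ v) = foldr act u (val v)"
  by (simp add: val_def)

lemma funpow_act [simp]:
  "(act (La s) ^^ n) ((i, j), k) = ((i + sg s * int n, j), k)"
  "(act (Lc s) ^^ n) ((i, j), k) = ((i + 2 * sg s * int n, j), k)"
  "(act (Ld s) ^^ n) ((i, j), k) = ((i + sg s * int n, j + sg s * int n), k)"
  by (induction n; simp add: algebra_simps)+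

lemma act_commute: "x \<noteq> Lt \<Longrightarrow> y \<noteq> Lt \<Longrightarrow> act x (act y g) = act y (act x g)"
  by (cases g; cases "fst g"; cases x; cases y) auto

lemma foldr_act_translation:
  "Lt \<notin> set u \<Longrightarrow> \<exists>m n. \<forall>i j k. foldr act u ((i, j), k) = ((i + m, j + n), k)"
proof (induction u)
  case (Cons x u)
  then obtain m n where "\<And>i j k. foldr act u ((i, j), k) = ((i + m, j + n), k)" by auto
  with Cons.prems show ?case by (cases x) (auto simp: add.assoc)
qed (auto intro!: exI[of _ 0])

abbreviation same_val :: "letter list \<Rightarrow> letter list set" where
  "same_val w \<equiv> {v. val v = val w}"

abbreviation least :: "letter list \<Rightarrow> bool" where
  "least w \<equiv> least_in (same_val w) w"

lemma least_commute:
  assumes "least (p @ x # y # q)" "x \<noteq> Lt" "y \<noteq> Lt"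
  shows "rank x \<le> rank y"
proof (rule ccontr)
  assume "\<not> rank x \<le> rank y"
  then have "\<not> least (p @ x # y # q)"
    by (intro not_least_in[of _ y "x # q"]) (auto simp: val_append act_commute assms)
  then show False using assms(1) by blast
qed

lemma least_sorted:
  "least (p @ u @ q) \<Longrightarrow> Lt \<notin> set u \<Longrightarrow> sorted (map rank u)"
proof (induction u arbitrary: p rule: induct_list012)
  case (3 x y u)
  have "rank x \<le> rank y" using least_commute[of p x y "u @ q"] 3(3,4) by auto
  moreover have "sorted (map rank (y # u))" using "3.IH"(2)[of "p @ [x]"] 3(3,4) by simp
  ultimately show ?case by fastforce
qed auto

text \<open>The block t u t is a translation, so a letter behind it commutes with it. Moved to its
  front, that letter takes the place of the greater letter t.\<close>

lemma least_no_tail: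
  assumes "least (p @ Lt # u @ Lt # q)" "Lt \<notin> set u" "Lt \<notin> set q"
  shows "q = []"
proof (rule ccontr)
  assume "q \<noteq> []"
  then obtain x r where q: "q = x # r" by (cases q) auto
  obtain m n where mn: "\<And>i j k. foldr act u ((i, j), k) = ((i + m, j + n), k)"
    using foldr_act_translation[OF assms(2)] by blast
  obtain i j k where r: "val r = ((i, j), k)" by (metis surj_pair)
  have "val (p @ x # Lt # u @ Lt # r) = val (p @ Lt # u @ Lt # x # r)"
    using assms(3) unfolding q by (cases x) (auto simp: val_append r mn algebra_simps)
  moreover have "rank x < rank Lt" using assms(3) unfolding q by (cases x) auto
  ultimately have "\<not> least (p @ Lt # u @ Lt # x # r)"
    by (intro not_least_in[of _ x "Lt # u @ Lt # r"]) auto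
  then show False using assms(1) q by simp
qed

lemma sorted_letters:
  assumes "sorted (map rank u)" "Lt \<notin> set u"
  shows "replicate (count_list u (Lc True)) (Lc True) @
      replicate (count_list u (Lc False)) (Lc False)
    @ replicate (count_list u (La True)) (La True) @ replicate (count_list u (La False)) (La False)
    @ replicate (count_list u (Ld True)) (Ld True) @
        replicate (count_list u (Ld False)) (Ld False) = u"
  using assms
proof (induction u)
  case (Cons x u)
  have z: "count_list u y = 0" if "rank y < rank x" for y
    using that Cons.prems(1) by (auto simp: count_list_0_iff)
  have "sorted (map rank u)" "Lt \<notin> set u" using Cons.prems by auto
  note IH = Cons.IH[OF this]
  show ?case
  proof (cases x)
    case (La s)
    then show ?thesis using IH by (cases s) (simp_all add: z)
  next
    case (Lc s)
    then show ?thesis using IH by (cases s) (simp_all add: z)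
  next
    case (Ld s)
    then show ?thesis using IH by (cases s) (simp_all add: z)
  qed (use Cons.prems in auto)
qed simp

lemma sorted_segment:
  assumes "sorted (map rank u)" "Lt \<notin> set u"
    and "count_list u (Lc (\<not> s)) = 0" "count_list u (La (\<not> s)) = 0"
    and "count_list u (Ld s) = 0 \<or> count_list u (Ld (\<not> s)) = 0"
  shows "replicate (count_list u (Lc s)) (Lc s) @ replicate (count_list u (La s)) (La s)
    @ replicate (count_list u (Ld s)) (Ld s) @ replicate (count_list u (Ld (\<not> s))) (Ld (\<not> s)) = u"
  using sorted_letters[OF assms(1,2)] assms(3-5) by (cases s) auto

text \<open>Both signs of c precede all other letters, so a competitor of the same length with one
  more leading letter \<open>Lc s\<close> wins at the first letter of \<open>r\<close>. Every
  exchange that produces a c at the front rests on this.\<close>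

lemma least_in_not_more_c:
  assumes "least_in W w" "w = replicate p (Lc s) @ r" "r \<noteq> []" "hd r \<notin> range Lc"
    and "replicate (Suc p) (Lc s) @ v \<in> W" "Suc (length v) = length r"
  shows False
proof -
  obtain x u where r: "r = x # u" using assms(3) by (cases r) auto
  have "replicate p (Lc s) @ Lc s # v \<in> W" using assms(5) by (simp add: replicate_app_Cons_same)
  moreover have "rank (Lc s) < rank x" using assms(4) r by (cases x) auto
  moreover have "length v = length u" using assms(6) r by simp
  ultimately have "\<not> least_in W (replicate p (Lc s) @ x # u)" by (rule not_least_in)
  then show False using assms(1,2) r by simp
qed

section \<open>Normal forms\<close>

definition nf_even :: "bool \<Rightarrow> nat \<Rightarrow> nat \<Rightarrow> nat \<Rightarrow> letter list" where
  "nf_even s p a q = replicate p (Lc s) @ replicate a (La s) @ replicate q (Ld s)"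

definition nf_mixed :: "bool \<Rightarrow> nat \<Rightarrow> nat \<Rightarrow> nat \<Rightarrow> letter list" where
  "nf_mixed s p a m = replicate p (Lc s) @ replicate a (La s) @ replicate m (Ld (\<not> s))"

definition nf_odd :: "bool \<Rightarrow> nat \<Rightarrow> nat \<Rightarrow> nat \<Rightarrow> nat \<Rightarrow> nat \<Rightarrow> letter list" where
  "nf_odd s p a e q b = replicate p (Lc s) @ replicate a (La s) @ replicate e (Ld s) @ [Lt]
    @ replicate q (Lc s) @ replicate b (La s)"

definition nf_twist :: "bool \<Rightarrow> nat \<Rightarrow> nat \<Rightarrow> nat \<Rightarrow> nat \<Rightarrow> nat \<Rightarrow> letter list" where
  "nf_twist s p a e q b = replicate p (Lc s) @ replicate a (La s) @ replicate e (Ld (\<not> s)) @ [Lt]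
    @ replicate q (Lc (\<not> s)) @ replicate b (La (\<not> s)) @ [Lt]"

lemmas nf_defs = nf_even_def nf_mixed_def nf_odd_def nf_twist_def

text \<open>The bound \<open>a + e + b \<le> 1\<close> combines the restrictions on conjugacy
  geodesics with exchanges that remove pairs of such letters. The condition
  \<open>2 \<le> q + b\<close> excludes c^p a^a d^{-e} t c^{-1} t, which has the same value and
  length as the smaller word c^{p+1} a^a d^{-e-2}.\<close>

definition minlen_nf :: "letter list set" where
  "minlen_nf =
    {nf_even s p a q |s p a q. a \<le> 1} \<union>
    {nf_mixed s p a m |s p a m. a \<le> 1 \<and> 1 \<le> m \<and> m \<le> 3 \<and> (m = 3 \<longrightarrow> a = 0) \<and> m \<le> p} \<union>
    {nf_odd s p a e q b |s p a e q b. a + e + b \<le> 1} \<union>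
    {nf_twist s p a e q b |s p a e q b. a + e + b \<le> 1 \<and> 1 + e \<le> p \<and> 2 \<le> q + b}"

lemma minlen_nf_cases [consumes 1, case_names even mixed odd twist]:
  assumes "w \<in> minlen_nf"
  obtains s p a q where "w = nf_even s p a q" "a \<le> 1"
  | s p a m where "w = nf_mixed s p a m" "a \<le> 1" "1 \<le> m" "m \<le> 3" "m = 3 \<Longrightarrow> a = 0" "m \<le> p"
  | s p a e q b where "w = nf_odd s p a e q b" "a + e + b \<le> 1"
  | s p a e q b where "w = nf_twist s p a e q b" "a + e + b \<le> 1" "1 + e \<le> p" "2 \<le> q + b"
  using assms unfolding minlen_nf_def
proof (elim UnE CollectE exE conjE)
qed (erule (1) that(1), erule (3) that(2), blast, assumption, erule (1) that(3), erule (3) that(4))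

lemma val_nf:
  "val (nf_even s p a q) = ((sg s * int (2 * p + a + q), sg s * int q), 0)"
  "val (nf_mixed s p a m) = ((sg s * (int (2 * p + a) - int m), - (sg s * int m)), 0)"
  "val (nf_odd s p a e q b) = ((sg s * int (2 * p + (a + e)), sg s * int (2 * q + (b + e))), 1)"
  "val (nf_twist s p a e q b) =
    ((sg s * (int (2 * p + a) - int e), - (sg s * int (2 * q + (b + e)))), 0)"
  by (auto simp: nf_defs val_def algebra_simps)

lemma length_nf:
  "length (nf_even s p a q) = p + a + q"
  "length (nf_mixed s p a m) = p + a + m"
  "length (nf_odd s p a e q b) = p + a + e + q + b + 1"
  "length (nf_twist s p a e q b) = p + a + e + q + b + 2"
  by (simp_all add: nf_defs)

lemma count_list_replicate: "count_list (replicate n x) y = (if x = y then n else 0)"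
  by (induction n) auto

lemma seg_count_replicate_append:
  "x \<noteq> Lt \<Longrightarrow> seg_count p y (replicate n x @ w) = (if p \<and> x = y then n else 0) + seg_count p y w"
  by (induction n) auto

lemma seg_count_append:
  "Lt \<notin> set u \<Longrightarrow> seg_count p y (u @ w) = (if p then count_list u y else 0) + seg_count p y w"
  by (induction u) auto

lemma conj_geo_nf_even: "a \<le> 1 \<Longrightarrow> conj_geo (nf_even s p a q)"
  unfolding conj_geo_def conj_geo_even_def nf_defs
      by (auto simp: count_list_replicate intro!: exI[of _ s])

lemma conj_geo_nf_mixed:
  "\<lbrakk>a \<le> 1; 1 \<le> m; m \<le> 3; m = 3 \<Longrightarrow> a = 0; m \<le> p\<rbrakk> \<Longrightarrow> conj_geo (nf_mixed s p a m)"
  unfolding conj_geo_def conj_geo_mixed_def nf_defs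
      by (auto simp: count_list_replicate intro!: exI[of _ s])

lemma conj_geo_nf_odd: "a + e + b \<le> 1 \<Longrightarrow> conj_geo (nf_odd s p a e q b)"
  unfolding conj_geo_def conj_geo_odd_def nf_defs
      by (auto simp: count_list_replicate intro!: exI[of _ s])

lemma conj_geo_nf_twist:
  "\<lbrakk>1 + e \<le> p; 1 \<le> q; e = 0 \<and> a \<le> 1 \<and> b \<le> 1 \<or> e = 1 \<and> a = 0 \<and> b = 0\<rbrakk> \<Longrightarrow>
      conj_geo (nf_twist s p a e q b)"
  unfolding conj_geo_def conj_geo_twist_def nf_defs
  by (auto simp: count_list_replicate seg_count_replicate_append intro!: exI[of _ s])

lemma conj_geo_if_minlen_nf:
  assumes "w \<in> minlen_nf"
  shows "conj_geo w"
  using assms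
proof (cases rule: minlen_nf_cases)
  case (twist s p a e q b)
  then show ?thesis by (auto intro!: conj_geo_nf_twist)
qed (auto intro: conj_geo_nf_even conj_geo_nf_mixed conj_geo_nf_odd)

section \<open>Distinct normal forms represent distinct elements\<close>

lemma double_add_unique:
  fixes p x p' x' :: nat
  shows "2 * p + x = 2 * p' + x' \<Longrightarrow> x \<le> 1 \<Longrightarrow> x' \<le> 1 \<Longrightarrow> p = p' \<and> x = x'"
  by presburger

lemma sg_mult_eqD: "sg s * int m = sg s' * int m' \<Longrightarrow> m = m' \<and> (s = s' \<or> m = 0)"
  by (cases s; cases s') auto

text \<open>The two coordinates of an even form never have opposite signs.\<close>

lemma val_nf_even_neq:
  assumes "m > 0" "k > 0"
  shows "val (nf_even s p a q) \<noteq> ((sg s' * k, - (sg s' * int m)), 0)"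
  using assms by (cases s; cases s') (auto simp: val_nf)

lemma val_nf_even_neq_mixed:
  "1 \<le> m \<Longrightarrow> m \<le> p' \<Longrightarrow> val (nf_even s p a q) \<noteq> val (nf_mixed s' p' a' m)"
  unfolding val_nf(2) by (rule val_nf_even_neq) auto

lemma val_nf_even_neq_twist:
  "1 + e' \<le> p' \<Longrightarrow> 2 \<le> q' + b' \<Longrightarrow> val (nf_even s p a q) \<noteq> val (nf_twist s' p' a' e' q' b')"
  unfolding val_nf(4) by (rule val_nf_even_neq) auto

text \<open>Comparing second coordinates, 2q' + b' + e' <= 3 together with q' + b' >= 2 forces q' =
  b' = 1 and m = 3, hence a = a' = e' = 0. The first coordinates then differ in parity.\<close>

lemma val_nf_mixed_neq_twist:
  assumes "1 \<le> m" "m \<le> 3" "m = 3 \<Longrightarrow> a = 0" "a' + e' + b' \<le> 1" "2 \<le> q' + b'"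
  shows "val (nf_mixed s p a m) \<noteq> val (nf_twist s' p' a' e' q' b')"
proof
  assume "val (nf_mixed s p a m) = val (nf_twist s' p' a' e' q' b')"
  then have eq: "sg s * (int (2 * p + a) - int m) = sg s' * (int (2 * p' + a') - int e')"
    "sg s * int m = sg s' * int (2 * q' + (b' + e'))"
    by (simp_all only: val_nf prod.inject neg_equal_iff_equal)
  note m = sg_mult_eqD[OF eq(2)]
  then have "m = 3 \<and> b' = 1 \<and> q' = 1 \<and> e' = 0 \<and> a' = 0" using assms by auto
  moreover have "s = s'" using m assms(1) by auto
  then have "2 * p + a + e' = 2 * p' + a' + m" using eq(1) by (cases s') auto
  ultimately show False using assms(3) by simp presburger
qed

lemma inj_on_val_minlen_nf: "inj_on val minlen_nf"
proof (rule inj_onI)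
  fix u v assume u: "u \<in> minlen_nf" and v: "v \<in> minlen_nf" and eq: "val u = val v"
  show "u = v"
    using u
  proof (cases rule: minlen_nf_cases)
    case u: (even s p a q)
    show ?thesis
      using v
    proof (cases rule: minlen_nf_cases)
      case v: (even s' p' a' q')
      note eqs = eq[unfolded u(1) v(1) val_nf prod.inject]
      note q = sg_mult_eqD[OF eqs[THEN conjunct1, THEN conjunct2]]
      note i = sg_mult_eqD[OF eqs[THEN conjunct1, THEN conjunct1]]
      then have "p = p' \<and> a = a'"
        using q u(2) v(2) by (intro double_add_unique; simp)
      then show ?thesis using u v q i by (auto simp: nf_even_def)
    next
      case v: (mixed s' p' a' m')
      then show ?thesis using eq u(1) val_nf_even_neq_mixed[of m' p' s p a q s' a'] by simp
    next
      case v: (twist s' p' a' e' q' b')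
      then show ?thesis using eq u(1) val_nf_even_neq_twist[of e' p' q' b' s p a q s' a'] by simp
    qed (use eq u(1) in \<open>simp_all add: val_nf\<close>)
  next
    case u: (mixed s p a m)
    show ?thesis
      using v
    proof (cases rule: minlen_nf_cases)
      case v: (even s' p' a' q')
      then show ?thesis
        using eq[symmetric] u(1) u(3,6) val_nf_even_neq_mixed[of m p s' p' a' q' s a] by simp
    next
      case v: (mixed s' p' a' m')
      note eqs = eq[unfolded u(1) v(1) val_nf prod.inject neg_equal_iff_equal]
      have m: "m = m' \<and> s = s'" using sg_mult_eqD[OF eqs[THEN conjunct1, THEN conjunct2]] u(3)
          by auto
      then have "2 * p + a = 2 * p' + a'" using eqs by (cases s) auto
      then have "p = p' \<and> a = a'" using u(2) v(2) by (rule double_add_unique)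
      then show ?thesis using m u(1) v(1) by simp
    next
      case v: (twist s' p' a' e' q' b')
      then show ?thesis using eq u val_nf_mixed_neq_twist[of m a a' e' b' q' s p s' p'] by simp
    qed (use eq u(1) in \<open>simp_all add: val_nf\<close>)
  next
    case u: (odd s p a e q b)
    show ?thesis
      using v
    proof (cases rule: minlen_nf_cases)
      case v: (odd s' p' a' e' q' b')
      note eqs = eq[unfolded u(1) v(1) val_nf prod.inject]
      note i = sg_mult_eqD[OF eqs[THEN conjunct1, THEN conjunct1]] and j =
          sg_mult_eqD[OF eqs[THEN conjunct1, THEN conjunct2]]
      have "p = p' \<and> a + e = a' + e'" "q = q' \<and> b + e = b' + e'"
        using i j u(2) v(2) by (intro double_add_unique; simp)+
      moreover from this have "a = a'" "e = e'" "b = b'" using u(2) v(2) by auto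
      ultimately show ?thesis using u v i j by (auto simp: nf_odd_def)
    qed (use eq u(1) in \<open>simp_all add: val_nf\<close>)
  next
    case u: (twist s p a e q b)
    show ?thesis
      using v
    proof (cases rule: minlen_nf_cases)
      case v: (even s' p' a' q')
      then show ?thesis
        using eq[symmetric] u(1) u(3,4) val_nf_even_neq_twist[of e p q b s' p' a' q' s a] by simp
    next
      case v: (mixed s' p' a' m')
      then show ?thesis using eq u val_nf_mixed_neq_twist[of m' a' a e b q s' p' s p] by simp
    next
      case v: (twist s' p' a' e' q' b')
      note eqs = eq[unfolded u(1) v(1) val_nf prod.inject neg_equal_iff_equal]
      note j = sg_mult_eqD[OF eqs[THEN conjunct1, THEN conjunct2]]
      then have qb: "q = q' \<and> b + e = b' + e'"
        using u(2) v(2) by (intro double_add_unique; simp)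
      have s: "s = s'" using j u(4) by auto
      then have "2 * p + a + e' = 2 * p' + a' + e" using eqs by (cases s') auto
      \<comment> \<open>The coordinate 2p + a - e, written as a multiple of 2 plus a remainder at
        most 1.\<close>
      then have "2 * (p - e) + (a + e) = 2 * (p' - e') + (a' + e')" using u(3) v(3) by simp
      then have "p - e = p' - e' \<and> a + e = a' + e'"
        using u(2) v(2) by (intro double_add_unique; simp)
      with qb have "p = p'" "a = a'" "e = e'" "b = b'" using u v by auto
      then show ?thesis using qb s u(1) v(1) by simp
    qed (use eq u(1) in \<open>simp_all add: val_nf\<close>)
  qed
qed

section \<open>Exchanges that bring a least word into normal form\<close>

lemma least_not_smaller:
  assumes "least w" "w = p @ x # u" "val (p @ y # v) = val w" "rank y < rank x"
      "length v = length u"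
  shows False
  using assms not_least_in[of p y v "same_val w" x u] by simp

lemma least_not_more_c:
  assumes "least w" "w = replicate p (Lc s) @ r" "r \<noteq> []" "hd r \<notin> range Lc"
    and "val (replicate (Suc p) (Lc s) @ v) = val w" "Suc (length v) = length r"
  shows False
  using least_in_not_more_c[OF assms(1-4), of v] assms(5,6) by simp

lemma hd_not_c: "hd (replicate a (La s) @ replicate e (Ld s') @ replicate f (Ld s'') @ Lt #
    r) \<notin> range Lc"
  by (cases a; cases e; cases f) auto

lemma split_one_Lt:
  assumes "count_list w Lt = 1"
  obtains u v where "w = u @ Lt # v" "Lt \<notin> set u" "Lt \<notin> set v"
proof -
  have "Lt \<in> set w" using assms by (metis count_notin zero_neq_one)
  then obtain u v where w: "w = u @ Lt # v" "Lt \<notin> set u" by (meson split_list_first)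
  then show ?thesis using that assms by (simp add: count_list_0_iff)
qed

lemma split_two_Lt:
  assumes "count_list w Lt = 2"
  obtains u v r where "w = u @ Lt # v @ Lt # r" "Lt \<notin> set u" "Lt \<notin> set v" "Lt \<notin> set r"
proof -
  have "Lt \<in> set w" using assms by (metis count_notin zero_neq_numeral)
  then obtain u x where w: "w = u @ Lt # x" "Lt \<notin> set u" by (meson split_list_first)
  then have "count_list x Lt = 1" using assms by simp
  then show ?thesis using that w by (metis split_one_Lt)
qed

lemma minlen_nf_if_conj_geo_odd:
  assumes "conj_geo_odd s w" "least w"
  shows "w \<in> minlen_nf"
proof -
  have conj_geo: "count_list w Lt = 1" "count_list w (La (\<not> s)) = 0"
    "count_list w (Lc (\<not> s)) = 0" "count_list w (Ld (\<not> s)) = 0" "count_list w (La s) \<le> 1"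
    using assms(1) unfolding conj_geo_odd_def by auto
  obtain u v where w: "w = u @ Lt # v" and uv: "Lt \<notin> set u" "Lt \<notin> set v"
    using split_one_Lt[OF conj_geo(1)] .
  define p a e where "p = count_list u (Lc s)" "a = count_list u (La s)" "e = count_list u (Ld s)"
  define q b f where "q = count_list v (Lc s)" "b = count_list v (La s)" "f = count_list v (Ld s)"
  have "sorted (map rank u)" using least_sorted[of "[]" u "Lt # v"] assms(2) w uv(1) by simp
  then have u: "u = replicate p (Lc s) @ replicate a (La s) @ replicate e (Ld s)"
    using sorted_segment[of u s] uv(1) conj_geo w by (simp add: p_a_e_def)
  have "sorted (map rank v)" using least_sorted[of "u @ [Lt]" v "[]"] assms(2) w uv(2) by simp
  then have v: "v = replicate q (Lc s) @ replicate b (La s) @ replicate f (Ld s)"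
    using sorted_segment[of v s] uv(2) conj_geo w by (simp add: q_b_f_def)
  have ab: "a + b \<le> 1" using conj_geo w by (simp add: p_a_e_def q_b_f_def)
  have w': "w = replicate p (Lc s) @ replicate a (La s) @ replicate e (Ld s) @ Lt #
      replicate q (Lc s) @ replicate b (La s) @ replicate f (Ld s)"
    using w u v by simp
  have "e + f \<le> 1"
  proof (rule ccontr)
    assume "\<not> e + f \<le> 1"
    then obtain k where k: "e + f = k + 2" by (metis add.commute le_Suc_ex not_less_eq_eq
        numeral_2_eq_2 One_nat_def)
    then have k': "int e = int k + 2 - int f" by linarith
    \<comment> \<open>Two letters d displace by (2, 2), as does one c on each side of t.\<close>
    show False
      by (rule least_not_more_c[OF assms(2) w',
          of "replicate a (La s) @ replicate k (Ld s) @ Lt # replicate (Suc q) (Lc s) @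
          replicate b (La s)"])
        (use k k' hd_not_c[of a s e s 0] in \<open>auto simp: w' val_def algebra_simps\<close>)
  qed
  moreover have "f = 0"
  proof (rule ccontr)
    assume "f \<noteq> 0"
    with \<open>e + f \<le> 1\<close> have [simp]: "f = 1" "e = 0" by auto
    \<comment> \<open>As d commutes with t, it can be moved ahead of the greater letter t.\<close>
    show False
      by (rule least_not_smaller[OF assms(2), of "replicate p (Lc s) @ replicate a (La s)" Lt
            "replicate q (Lc s) @ replicate b (La s) @ [Ld s]" "Ld s"
                "Lt # replicate q (Lc s) @ replicate b (La s)"])
        (auto simp: w' val_def algebra_simps)
  qed
  moreover have "e + a \<le> 1"
  proof (rule ccontr)
    assume "\<not> e + a \<le> 1"
    with calculation ab have [simp]: "a = 1" "e = 1" "b = 0" "f = 0" by auto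
    \<comment> \<open>Letters a and d before t displace by (2, 1), as do c before and a after
      it.\<close>
    show False
      by (rule least_not_more_c[OF assms(2) w', of "Lt # replicate q (Lc s) @ [La s]"])
        (auto simp: w' val_def algebra_simps)
  qed
  moreover have "e + b \<le> 1"
  proof (rule ccontr)
    assume "\<not> e + b \<le> 1"
    with calculation ab have [simp]: "b = 1" "e = 1" "a = 0" "f = 0" by auto
    \<comment> \<open>A d before and an a after t displace by (1, 2), as do a before and c after
      it.\<close>
    show False
      by (rule least_not_smaller[OF assms(2), of "replicate p (Lc s)" "Ld s"
            "Lt # replicate q (Lc s) @ [La s]" "La s" "Lt # replicate (Suc q) (Lc s)"])
        (auto simp: w' val_def algebra_simps)
  qed
  ultimately have "f = 0" "a + e + b \<le> 1" using ab by linarith+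
  moreover from \<open>f = 0\<close> have "w = nf_odd s p a e q b" using w' by (simp add: nf_odd_def)
  ultimately show ?thesis unfolding minlen_nf_def by blast
qed

lemma minlen_nf_if_conj_geo_even:
  assumes "conj_geo_even s w" "least w"
  shows "w \<in> minlen_nf"
proof -
  have "Lt \<notin> set w" using assms(1) by (simp add: conj_geo_even_def count_list_0_iff)
  moreover from this have "sorted (map rank w)" using least_sorted[of "[]" w "[]"] assms(2) by simp
  ultimately have "w = nf_even s (count_list w (Lc s)) (count_list w (La s)) (count_list w (Ld s))"
    using sorted_segment[of w s] assms(1) by (simp add: conj_geo_even_def nf_even_def)
  then show ?thesis using assms(1) unfolding minlen_nf_def conj_geo_even_def by blast
qed

lemma minlen_nf_if_conj_geo_mixed:
  assumes "conj_geo_mixed s w" "least w"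
  shows "w \<in> minlen_nf"
proof -
  have "Lt \<notin> set w" using assms(1) by (simp add: conj_geo_mixed_def count_list_0_iff)
  moreover from this have "sorted (map rank w)" using least_sorted[of "[]" w "[]"] assms(2) by simp
  ultimately have "w = nf_mixed s (count_list w (Lc s)) (count_list w (La s)) (count_list w (Ld (\<not>
      s)))"
    using sorted_segment[of w s] assms(1) by (simp add: conj_geo_mixed_def nf_mixed_def)
  then show ?thesis using assms(1) unfolding minlen_nf_def conj_geo_mixed_def by blast
qed

lemma minlen_nf_if_conj_geo_twist:
  assumes "conj_geo_twist s w" "least w"
  shows "w \<in> minlen_nf"
proof -
  have "count_list w Lt = 2" using assms(1) unfolding conj_geo_twist_def by auto
  then obtain u v r where w: "w = u @ Lt # v @ Lt # r" and uv: "Lt \<notin> set u" "Lt \<notin> set v"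
      "Lt \<notin> set r"
    using split_two_Lt by blast
  have "r = []" using least_no_tail[of u v r] assms(2) w uv by simp
  define p a e e' where "p = count_list u (Lc s)" "a = count_list u (La s)"
    "e = count_list u (Ld s)" "e' = count_list u (Ld (\<not> s))"
  define q b f f' where "q = count_list v (Lc (\<not> s))" "b = count_list v (La (\<not> s))"
    "f = count_list v (Ld s)" "f' = count_list v (Ld (\<not> s))"
  note defs = p_a_e_e'_def q_b_f_f'_def
  have conj_geo: "count_list u (La (\<not> s)) = 0" "count_list u (Lc (\<not> s)) = 0"
      "count_list v (La s) = 0"
    "count_list v (Lc s) = 0" "1 + (e' + f') \<le> p" "1 + (e + f) \<le> q"
    "e + f + (e' + f') = 0 \<and> a \<le> 1 \<and> b \<le> 1 \<or> e + f + (e' + f') = 1 \<and> a = 0 \<and> b = 0"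
    using assms(1) uv(1,2) unfolding conj_geo_twist_def w \<open>r = []\<close> defs
        by (simp_all add: seg_count_append)
  have d: "count_list u (Ld s) = 0 \<or> count_list u (Ld (\<not> s)) = 0"
    "count_list v (Ld (\<not> s)) = 0 \<or> count_list v (Ld s) = 0"
    using conj_geo(7) unfolding defs by linarith+
  have "sorted (map rank u)" using least_sorted[of "[]" u "Lt # v @ [Lt]"] assms(2) w uv(1) \<open>r =
      []\<close> by simp
  then have u: "u = replicate p (Lc s) @ replicate a (La s) @ replicate e (Ld s) @
      replicate e' (Ld (\<not> s))"
    using sorted_segment[of u s] uv(1) conj_geo(1,2) d(1) by (simp add: defs)
  have "sorted (map rank v)" using least_sorted[of "u @ [Lt]" v "[Lt]"] assms(2) w uv(2) \<open>r = []\<close>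
      by simp
  then have v: "v = replicate q (Lc (\<not> s)) @ replicate b (La (\<not> s)) @ replicate f' (Ld (\<not> s)) @
      replicate f (Ld s)"
    using sorted_segment[of v "\<not> s"] uv(2) conj_geo(3,4) d(2) by (simp add: defs)
  have w': "w = replicate p (Lc s) @ replicate a (La s) @ replicate e (Ld s) @
      replicate e' (Ld (\<not> s)) @ Lt #
      replicate q (Lc (\<not> s)) @ replicate b (La (\<not> s)) @ replicate f' (Ld (\<not> s)) @
          replicate f (Ld s) @ [Lt]"
    using w u v \<open>r = []\<close> by simp
  have "f = 0"
  proof (rule ccontr)
    assume "f \<noteq> 0"
    with conj_geo(7) have [simp]: "f = 1" "f' = 0" "e = 0" "e' = 0" "a = 0" "b = 0" by auto
    show False
      by (rule least_not_smaller[OF assms(2), of "replicate p (Lc s)" Lt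
            "replicate q (Lc (\<not> s)) @ [Ld s, Lt]" "Ld s" "Lt # replicate q (Lc (\<not> s)) @ [Lt]"])
        (auto simp: w' val_def algebra_simps)
  qed
  moreover have "f' = 0"
  proof (rule ccontr)
    assume "f' \<noteq> 0"
    with conj_geo(7) have [simp]: "f' = 1" "f = 0" "e = 0" "e' = 0" "a = 0" "b = 0" by auto
    show False
      by (rule least_not_smaller[OF assms(2), of "replicate p (Lc s)" Lt
            "replicate q (Lc (\<not> s)) @ [Ld (\<not> s), Lt]" "Ld (\<not> s)"
                "Lt # replicate q (Lc (\<not> s)) @ [Lt]"])
        (auto simp: w' val_def algebra_simps)
  qed
  moreover have "e = 0"
  proof (rule ccontr)
    assume "e \<noteq> 0"
    with conj_geo(7) have [simp]: "e = 1" "f = 0" "f' = 0" "e' = 0" "a = 0" "b = 0" by auto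
    obtain k where [simp]: "q = Suc k" using conj_geo(6) by (cases q) auto
    \<comment> \<open>In the direction \<open>s\<close>, a letter d and a letter c^{-1} behind t
      displace by (1, -1), as do c and d^{-1} in front.\<close>
    show False
      by (rule least_not_more_c[OF assms(2) w', of "Ld (\<not> s) # Lt # replicate k (Lc (\<not> s)) @ [Lt]"])
        (auto simp: w' val_def algebra_simps)
  qed
  moreover have "a + b \<le> 1"
  proof (rule ccontr)
    assume "\<not> a + b \<le> 1"
    with conj_geo(7) have [simp]: "e = 0" "f = 0" "f' = 0" "e' = 0" "a = 1" "b = 1" by auto
    \<comment> \<open>Likewise a before t and a^{-1} behind it displace by (1, -1) and are exchanged
      for c d^{-1}.\<close>
    show False
      by (rule least_not_more_c[OF assms(2) w', of "Ld (\<not> s) # Lt # replicate q (Lc (\<not> s)) @ [Lt]"])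
        (auto simp: w' val_def algebra_simps)
  qed
  moreover have "2 \<le> q + b"
  proof (rule ccontr)
    assume "\<not> 2 \<le> q + b"
    with conj_geo(6) calculation have [simp]: "q = 1" "b = 0" "e = 0" "f = 0" "f' = 0" by auto
    \<comment> \<open>Both t c^{-1} t and c d^{-2} have three letters and displace by (0,
      -2).\<close>
    show False
      by (rule least_not_more_c[OF assms(2) w',
          of "replicate a (La s) @ replicate (e' + 2) (Ld (\<not> s))"])
        (use hd_not_c[of a s e' "\<not> s" 0] in \<open>auto simp: w' val_def algebra_simps\<close>)
  qed
  ultimately have "w = nf_twist s p a e' q b" "a + e' + b \<le> 1" "1 + e' \<le> p" "2 \<le> q + b"
    using w' conj_geo by (auto simp: nf_twist_def)
  then show ?thesis unfolding minlen_nf_def by blast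
qed

lemma minlen_nf_if_least: "conj_geo w \<Longrightarrow> least w \<Longrightarrow> w \<in> minlen_nf"
  unfolding conj_geo_def
  using minlen_nf_if_conj_geo_odd minlen_nf_if_conj_geo_even minlen_nf_if_conj_geo_mixed
      minlen_nf_if_conj_geo_twist by blast

lemma minlen_nf_eq: "{w. conj_geo w \<and> least w} = minlen_nf"
proof (intro equalityI subsetI)
  fix w assume w: "w \<in> minlen_nf"
  obtain y where y: "least_in (same_val w) y" using ex_least_in[of "same_val w"] by blast
  then have val: "val y = val w" by (simp add: least_in_def)
  have "int (length y) \<le> int (length w)" using length_le_if_least_in[OF y] by simp
  also have "\<dots> = conj_len (val y)" using conj_geo_if_minlen_nf[OF w] conj_len_eq_iff_conj_geo val
      by simp
  finally have "conj_geo y" using conj_len_val_le[of y] conj_len_eq_iff_conj_geo by simp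
  moreover have "least y" using y val by simp
  ultimately have "y \<in> minlen_nf" by (rule minlen_nf_if_least)
  then have "y = w" using inj_on_val_minlen_nf w val by (simp add: inj_on_def)
  with \<open>conj_geo y\<close> \<open>least y\<close> show "w \<in> {w. conj_geo w \<and> least w}" by simp
qed (use minlen_nf_if_least in blast)

section \<open>Shortlex least words in conjugacy classes\<close>

text \<open>Conjugacy in coordinates; \<open>conj_class_SD\<close> below connects it with the
  group.\<close>

fun conj_rel :: "elt \<Rightarrow> elt \<Rightarrow> bool" where
  "conj_rel ((i, j), k) ((i', j'), k') \<longleftrightarrow> k = k' \<and>
    (if k = 0 then i' = i \<and> j' = j \<or> i' = j \<and> j' = i else i' + j' = i + j)"

lemma conj_rel_refl [simp]: "conj_rel g g"
  by (cases g; cases "fst g") auto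

lemma conj_rel_sym: "conj_rel g h \<Longrightarrow> conj_rel h g"
  by (cases g; cases "fst g"; cases h; cases "fst h") (auto split: if_splits)

lemma conj_rel_trans: "conj_rel g h \<Longrightarrow> conj_rel h f \<Longrightarrow> conj_rel g f"
  by (cases g; cases "fst g"; cases h; cases "fst h"; cases f; cases "fst f")
      (auto split: if_splits)

lemma conj_len_conj_rel: "conj_rel g h \<Longrightarrow> conj_len g = conj_len h"
  by (cases g; cases "fst g"; cases h; cases "fst h")
      (auto split: if_splits simp: ac_simps min.commute)

section \<open>Every conjugacy class contains a conjugacy geodesic\<close>

lemma nonneg_eq_double_add:
  assumes "0 \<le> n"
  shows "\<exists>p a. a \<le> 1 \<and> n = 2 * int p + int a"
  using assms by (intro exI[of _ "nat (n div 2)"] exI[of _ "nat (n mod 2)"]) auto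

lemma ex_conj_geo_even:
  assumes "\<bar>j\<bar> \<le> \<bar>i\<bar>" "0 \<le> i * j"
  shows "\<exists>w. conj_geo w \<and> val w = ((i, j), 0)"
proof -
  obtain p a where pa: "a \<le> 1" "\<bar>i\<bar> - \<bar>j\<bar> = 2 * int p + int a"
    using nonneg_eq_double_add[of "\<bar>i\<bar> - \<bar>j\<bar>"] assms(1) by auto
  have "val (nf_even (0 \<le> i + j) p a (nat \<bar>j\<bar>)) = ((i, j), 0)"
    using pa(2) assms unfolding val_nf zero_le_mult_int_iff by auto
  then show ?thesis using conj_geo_nf_even[OF pa(1)] by blast
qed

text \<open>The pattern with two letters t needs a c in each direction and never produces a
  coordinate of absolute value 1. Such a coordinate is supplied by a single letter d.\<close>

lemma ex_conj_geo_opposite: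
  assumes "0 < i" "j < 0"
  shows "\<exists>w. conj_geo w \<and> conj_rel ((i, j), 0) (val w)"
proof -
  consider "j = -1" | "i = 1" | "2 \<le> i" "2 \<le> - j" using assms by linarith
  then show ?thesis
  proof cases
    case 1
    obtain p a where pa: "a \<le> 1" "i + 1 = 2 * int p + int a"
      using nonneg_eq_double_add[of "i + 1"] assms(1) by auto
    have "conj_rel ((i, j), 0) (val (nf_mixed True p a 1))" using pa(2) 1 unfolding val_nf by auto
    moreover have "conj_geo (nf_mixed True p a 1)" using pa assms(1)
        by (intro conj_geo_nf_mixed) auto
    ultimately show ?thesis by blast
  next
    case 2
    obtain p a where pa: "a \<le> 1" "- j + 1 = 2 * int p + int a"
      using nonneg_eq_double_add[of "- j + 1"] assms(2) by auto
    have "conj_rel ((i, j), 0) (val (nf_mixed False p a 1))" using pa(2) 2 unfolding val_nf by auto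
    moreover have "conj_geo (nf_mixed False p a 1)" using pa assms(2)
        by (intro conj_geo_nf_mixed) auto
    ultimately show ?thesis by blast
  next
    case 3
    obtain p a where pa: "a \<le> 1" "i = 2 * int p + int a"
      using nonneg_eq_double_add[of "i"] assms(1) by auto
    obtain q b where qb: "b \<le> 1" "- j = 2 * int q + int b"
      using nonneg_eq_double_add[of "- j"] assms(2) by auto
    show ?thesis
    proof (cases "a = 1 \<and> b = 1")
      case True
      \<comment> \<open>The letter d^{-1} makes both coordinates odd; the additional c offsets it in
        the first one, where 2(p + 1) - 1 = 2p + 1.\<close>
      then have "conj_rel ((i, j), 0) (val (nf_twist True (Suc p) 0 1 q 0))"
        using pa(2) qb(2) unfolding val_nf by auto
      moreover have "conj_geo (nf_twist True (Suc p) 0 1 q 0)" using True pa qb 3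
          by (intro conj_geo_nf_twist) auto
      ultimately show ?thesis by blast
    next
      case False
      have "conj_rel ((i, j), 0) (val (nf_twist True p a 0 q b))"
        using pa(2) qb(2) unfolding val_nf by auto
      moreover have "conj_geo (nf_twist True p a 0 q b)" using pa qb 3
          by (intro conj_geo_nf_twist) auto
      ultimately show ?thesis by blast
    qed
  qed
qed

lemma ex_conj_geo:
  assumes "snd g \<in> {0, 1}"
  shows "\<exists>w. conj_geo w \<and> conj_rel g (val w)"
proof -
  obtain i j k where g: "g = ((i, j), k)" by (metis surj_pair)
  show ?thesis
  proof (cases "k = 0")
    case k: True
    consider "\<bar>j\<bar> \<le> \<bar>i\<bar>" "0 \<le> i * j" | "\<bar>i\<bar> \<le> \<bar>j\<bar>" "0 \<le> j * i" | "0 < i" "j < 0" | "0 < j" "i < 0"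
      unfolding zero_le_mult_int_iff by linarith
    then show ?thesis
    proof cases
      case 1
      then obtain w where "conj_geo w" "val w = ((i, j), 0)" using ex_conj_geo_even by auto
      then show ?thesis unfolding g k by (intro exI[of _ w]) simp
    next
      case 2
      then obtain w where "conj_geo w" "val w = ((j, i), 0)" using ex_conj_geo_even by auto
      then show ?thesis unfolding g k by (intro exI[of _ w]) simp
    next
      case 3
      then show ?thesis using ex_conj_geo_opposite g k by simp
    next
      case 4
      then obtain w where "conj_geo w" "conj_rel ((j, i), 0) (val w)" using ex_conj_geo_opposite
          by blast
      moreover have "conj_rel ((i, j), 0) ((j, i), 0)" by simp
      ultimately show ?thesis unfolding g k by (meson conj_rel_trans)
    qed
  next
    case False
    then have k: "k = 1" using assms g by simp
    obtain p a where pa: "a \<le> 1" "\<bar>i + j\<bar> = 2 * int p + int a"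
        using nonneg_eq_double_add[of "\<bar>i + j\<bar>"] by auto
    then have "conj_rel g (val (nf_odd (0 \<le> i + j) p a 0 0 0))"
      unfolding g k val_nf by auto
    moreover have "conj_geo (nf_odd (0 \<le> i + j) p a 0 0 0)" using pa by (intro conj_geo_nf_odd) auto
    ultimately show ?thesis by blast
  qed
qed

section \<open>Normal forms of conjugacy classes\<close>

abbreviation same_class :: "letter list \<Rightarrow> letter list set" where
  "same_class w \<equiv> {v. conj_rel (val w) (val v)}"

abbreviation class_least :: "letter list \<Rightarrow> bool" where
  "class_least w \<equiv> least_in (same_class w) w"

text \<open>A word that begins with c^{-1} loses to a conjugate of the same length that begins with
  c, if there is one. Exchanging the coordinates provides such a conjugate for the mixed and twisted
  forms with \<open>s = False\<close>, except for c^{-p} a^{-a} d with p + a >= 2.\<close>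

definition class_nf :: "letter list set" where
  "class_nf =
    {nf_even s p a q |s p a q. a \<le> 1} \<union>
    {nf_mixed True p a m |p a m. a \<le> 1 \<and> 1 \<le> m \<and> m \<le> 3 \<and> (m = 3 \<longrightarrow> a = 0) \<and> m \<le> p} \<union>
    {nf_mixed False p a 1 |p a. a \<le> 1 \<and> 1 \<le> p \<and> 2 \<le> p + a} \<union>
    {nf_odd s p a 0 0 0 |s p a. a \<le> 1} \<union>
    {nf_twist True p a e q b |p a e q b. a + e + b \<le> 1 \<and> 1 + e \<le> p \<and> 2 \<le> q + b}"

lemma class_nfI:
  "a \<le> 1 \<Longrightarrow> nf_even s p a q \<in> class_nf"
  "a \<le> 1 \<Longrightarrow> 1 \<le> m \<Longrightarrow> m \<le> 3 \<Longrightarrow> (m = 3 \<Longrightarrow> a = 0) \<Longrightarrow> m \<le> p \<Longrightarrow> nf_mixed True p a m \<in> class_nf"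
  "a \<le> 1 \<Longrightarrow> 1 \<le> p \<Longrightarrow> 2 \<le> p + a \<Longrightarrow> nf_mixed False p a 1 \<in> class_nf"
  "a \<le> 1 \<Longrightarrow> nf_odd s p a 0 0 0 \<in> class_nf"
  "a + e + b \<le> 1 \<Longrightarrow> 1 + e \<le> p \<Longrightarrow> 2 \<le> q + b \<Longrightarrow> nf_twist True p a e q b \<in> class_nf"
  unfolding class_nf_def by blast+

lemma class_nf_subset: "class_nf \<subseteq> minlen_nf"
proof -
  have "{nf_even s p a q |s p a q. a \<le> 1} \<subseteq> minlen_nf" unfolding minlen_nf_def by blast
  moreover have "{nf_mixed True p a m |p a m. a \<le> 1 \<and> 1 \<le> m \<and> m \<le> 3 \<and> (m = 3 \<longrightarrow> a = 0) \<and> m \<le>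
      p} \<subseteq> minlen_nf"
    unfolding minlen_nf_def by blast
  moreover have "nf_mixed False p a 1 \<in> minlen_nf" if "a \<le> 1" "1 \<le> p" for p a
  proof -
    have "a \<le> 1 \<and> 1 \<le> (1::nat) \<and> 1 \<le> (3::nat) \<and> (1 = (3::nat) \<longrightarrow> a = 0) \<and> 1 \<le> p" using that by simp
    then show ?thesis unfolding minlen_nf_def by blast
  qed
  moreover have "nf_odd s p a 0 0 0 \<in> minlen_nf" if "a \<le> 1" for s p a
  proof -
    have "a + 0 + 0 \<le> 1" using that by simp
    then show ?thesis unfolding minlen_nf_def by blast
  qed
  moreover have "{nf_twist True p a e q b |p a e q b. a + e + b \<le> 1 \<and> 1 + e \<le> p \<and> 2 \<le> q +
      b} \<subseteq> minlen_nf"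
    unfolding minlen_nf_def by blast
  ultimately show ?thesis unfolding class_nf_def by auto
qed

lemma class_least_not_smaller:
  assumes "class_least w" "w = p @ x # u" "conj_rel (val w) (val (p @ y # v))" "rank y < rank x"
    "length v = length u"
  shows False
  using assms not_least_in[of p y v "same_class w" x u] by simp

lemma class_least_not_more_c:
  assumes "class_least w" "w = replicate p (Lc s) @ r" "r \<noteq> []" "hd r \<notin> range Lc"
    and "conj_rel (val w) (val (replicate (Suc p) (Lc s) @ v))" "Suc (length v) = length r"
  shows False
  using least_in_not_more_c[OF assms(1-4), of v] assms(5,6) by simp

lemma class_nf_if_minlen_nf:
  assumes "w \<in> minlen_nf" "class_least w"
  shows "w \<in> class_nf"
  using assms(1)
proof (cases rule: minlen_nf_cases)
  case (even s p a q)
  then show ?thesis using class_nfI(1) by simp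
next
  case (mixed s p a m)
  show ?thesis
  proof (cases s)
    case True
    then show ?thesis using mixed class_nfI(2) by simp
  next
    case s: False
    obtain k where p: "p = Suc k" using mixed by (cases p) auto
    have w: "w = [] @ Lc False # replicate k (Lc False) @ replicate a (La False) @
        replicate m (Ld True)"
      using mixed s p by (simp add: nf_mixed_def)
    have "m = 1"
    proof (rule ccontr)
      assume "m \<noteq> 1"
      with mixed consider "m = 2" | "m = 3" "a = 0" by linarith
      then show False
      proof cases
        case 1
        \<comment> \<open>The value (2 - 2p - a, 2) is conjugate to (2, 2 - 2p - a), which c t
          c^{-k} a^{-a} t represents for p = k + 1.\<close>
        show False
          by (rule class_least_not_smaller[OF assms(2) w, of "Lc True"
              "Lt # replicate k (Lc False) @ replicate a (La False) @ [Lt]"])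
            (use 1 in \<open>auto simp: w val_def algebra_simps\<close>)
      next
        case 2
        then obtain l where "k = Suc l" using mixed p by (cases k) auto
        \<comment> \<open>The value (3 - 2p, 3) is conjugate to (3, 3 - 2p), which c c d^{-1} t
          c^{-l} t represents for p = l + 2.\<close>
        show False
          by (rule class_least_not_smaller[OF assms(2) w, of "Lc True"
              "Lc True # Ld False # Lt # replicate l (Lc False) @ [Lt]"])
            (use 2 \<open>k = Suc l\<close> in \<open>auto simp: w val_def algebra_simps\<close>)
      qed
    qed
    moreover have "2 \<le> p + a"
    proof (rule ccontr)
      assume "\<not> 2 \<le> p + a"
      then have "k = 0" "a = 0" using p by auto
      show False
        by (rule class_least_not_smaller[OF assms(2) w, of "Lc True" "[Ld False]"])
          (use \<open>m = 1\<close> \<open>k = 0\<close> \<open>a = 0\<close> in \<open>auto simp: w val_def\<close>)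
    qed
    ultimately show ?thesis using mixed s class_nfI(3) by simp
  qed
next
  case (odd s p a e q b)
  then have w: "w = replicate p (Lc s) @ replicate a (La s) @ replicate e (Ld s) @ Lt #
      replicate q (Lc s) @ replicate b (La s)"
    by (simp add: nf_odd_def)
  \<comment> \<open>With one letter t only the sum of the coordinates is invariant under
    conjugation, so letters may be moved to the front of t, and d contributes as much as c.\<close>
  have "e = 0"
  proof (rule ccontr)
    assume "e \<noteq> 0"
    with odd(2) have [simp]: "e = 1" "a = 0" "b = 0" by auto
    show False
      by (rule class_least_not_more_c[OF assms(2) w, of "Lt # replicate q (Lc s)"])
        (auto simp: w val_def algebra_simps)
  qed
  moreover have "b = 0"
  proof (rule ccontr)
    assume "b \<noteq> 0"
    with odd(2) have [simp]: "b = 1" "a = 0" "e = 0" by auto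
    show False
      by (rule class_least_not_smaller[OF assms(2), of "replicate p (Lc s)" Lt
          "replicate q (Lc s) @ [La s]"
            "La s" "Lt # replicate q (Lc s)"])
        (auto simp: w val_def algebra_simps)
  qed
  moreover have "q = 0"
  proof (rule ccontr)
    assume "q \<noteq> 0"
    then obtain k where [simp]: "q = Suc k" by (cases q) auto
    show False
      by (rule class_least_not_more_c[OF assms(2) w,
          of "replicate a (La s) @ Lt # replicate k (Lc s)"])
        (use calculation hd_not_c[of a s 0 s 0] in \<open>auto simp: w val_def algebra_simps\<close>)
  qed
  ultimately show ?thesis using odd class_nfI(4) by simp
next
  case (twist s p a e q b)
  show ?thesis
  proof (cases s)
    case True
    then show ?thesis using twist class_nfI(5) by simp
  next
    case s: False
    obtain k l where p: "p = Suc k" "q = Suc l" using twist by (cases p; cases q) auto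
    have w: "w = [] @ Lc False # replicate k (Lc False) @ replicate a (La False) @
        replicate e (Ld True) @ [Lt]
        @ replicate q (Lc True) @ replicate b (La True) @ [Lt]"
      using twist s p by (simp add: nf_twist_def)
    \<comment> \<open>Exchanging the coordinates exchanges the segments around the first t, and the
      one with positive c comes to the front.\<close>
    have False
      by (rule class_least_not_smaller[OF assms(2) w, of "Lc True"
          "replicate l (Lc True) @ replicate b (La True) @ [Lt]
        @ replicate p (Lc False) @ replicate a (La False) @ replicate e (Ld True) @ [Lt]"])
        (use p in \<open>auto simp: w val_def algebra_simps\<close>)
    then show ?thesis ..
  qed
qed

text \<open>These conditions cut out a fundamental domain for conjugacy. Of (1, j) and (j, 1) with j
  <= -2 it contains the second, the value of some c^{-p} a^{-a} d; otherwise, for opposite signs,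
  the positive coordinate comes first.\<close>

lemma val_class_nf:
  assumes "w \<in> class_nf" "val w = ((i, j), k)"
  shows "k = 0 \<Longrightarrow> 0 \<le> i * j \<and> \<bar>j\<bar> \<le> \<bar>i\<bar> \<or> j < 0 \<and> 0 < i \<and> (i = 1 \<longrightarrow> j = - 1) \<or> j = 1 \<and> i \<le> - 2"
    and "k \<noteq> 0 \<Longrightarrow> j = 0"
proof -
  consider s p a q where "w = nf_even s p a q"
    | p a m where "w = nf_mixed True p a m" "1 \<le> m" "m \<le> p"
    | p a where "w = nf_mixed False p a 1" "1 \<le> p" "2 \<le> p + a"
    | s p a where "w = nf_odd s p a 0 0 0"
    | p a e q b where "w = nf_twist True p a e q b" "a + e + b \<le> 1" "1 + e \<le> p" "2 \<le> q + b"
    using assms(1) unfolding class_nf_def by blast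
  then have "(k = 0 \<longrightarrow> 0 \<le> i * j \<and> \<bar>j\<bar> \<le> \<bar>i\<bar> \<or> j < 0 \<and> 0 < i \<and> (i = 1 \<longrightarrow> j = - 1) \<or> j = 1 \<and> i \<le> - 2)
    \<and> (k \<noteq> 0 \<longrightarrow> j = 0)"
  proof cases
    case (1 s p a q)
    then show ?thesis using assms(2) by (cases s)
        (auto simp: val_nf zero_le_mult_int_iff mult_le_0_iff)
  next
    case 2
    then show ?thesis using assms(2) by (auto simp: val_nf zero_le_mult_int_iff)
  next
    case 3
    then show ?thesis using assms(2) by (auto simp: val_nf zero_le_mult_int_iff)
  next
    case 4
    then show ?thesis using assms(2) by (auto simp: val_nf zero_le_mult_int_iff)
  next
    case 5
    then show ?thesis using assms(2) by (auto simp: val_nf zero_le_mult_int_iff)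
  qed
  then show "k = 0 \<Longrightarrow> 0 \<le> i * j \<and> \<bar>j\<bar> \<le> \<bar>i\<bar> \<or> j < 0 \<and> 0 < i \<and> (i = 1 \<longrightarrow> j = - 1) \<or> j = 1 \<and> i \<le> - 2"
    and "k \<noteq> 0 \<Longrightarrow> j = 0" by blast+
qed

lemma class_nf_unique:
  assumes "u \<in> class_nf" "v \<in> class_nf" "conj_rel (val u) (val v)"
  shows "u = v"
proof -
  obtain i j k where u: "val u = ((i, j), k)" by (metis surj_pair)
  obtain i' j' k' where v: "val v = ((i', j'), k')" by (metis surj_pair)
  have "val u = val v"
    using assms(3) val_class_nf[OF assms(1) u] val_class_nf[OF assms(2) v]
    unfolding u v zero_le_mult_int_iff by (auto split: if_splits)
  then show ?thesis using inj_on_val_minlen_nf class_nf_subset assms(1,2) by (meson inj_onD subsetD)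
qed

lemma least_in_subset: "least_in W w \<Longrightarrow> V \<subseteq> W \<Longrightarrow> w \<in> V \<Longrightarrow> least_in V w"
  unfolding least_in_def by blast

lemma class_nf_if_least_in_class:
  assumes "class_least w"
  shows "w \<in> class_nf"
proof -
  have "least w" using assms by (rule least_in_subset) auto
  moreover have "conj_geo w"
  proof -
    obtain v where v: "conj_geo v" "conj_rel (val w) (val v)" using ex_conj_geo[OF snd_val] by blast
    then have "length w \<le> length v" using length_le_if_least_in[OF assms] by simp
    moreover have "int (length v) = conj_len (val w)"
        using v conj_len_eq_iff_conj_geo conj_len_conj_rel by metis
    ultimately show ?thesis using conj_len_val_le[of w] conj_len_eq_iff_conj_geo[of w] by linarith
  qed
  ultimately have "w \<in> minlen_nf" using minlen_nf_if_least by blast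
  then show ?thesis using class_nf_if_minlen_nf assms by blast
qed

lemma class_nf_eq: "{w. class_least w} = class_nf"
proof (intro equalityI subsetI)
  fix w assume w: "w \<in> class_nf"
  obtain y where y: "least_in (same_class w) y"
    using ex_least_in[of "same_class w"] conj_rel_refl by blast
  then have rel: "conj_rel (val w) (val y)" by (simp add: least_in_def)
  then have "same_class y = same_class w" using conj_rel_sym conj_rel_trans by blast
  then have "class_least y" using y by simp
  then have "y = w" using class_nf_if_least_in_class class_nf_unique[OF w _ rel] by simp
  with \<open>class_least y\<close> show "w \<in> {w. class_least w}" by simp
qed (use class_nf_if_least_in_class in blast)

section \<open>Regularity of the explicit languages\<close>

lemma quotients_one_power: "finitely_many_quotients {replicate p x @ u |p. k \<le> p}"
proof -
  have "{replicate p x @ u |p. k \<le> p} = powers_from k x \<odot> {u}"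
    unfolding language_conc_def powers_from_def by blast
  then show ?thesis
    by (simp only: finitely_many_quotients_conc finitely_many_quotients_powers_from
        finitely_many_quotients_singleton)
qed

lemma quotients_two_powers:
  "finitely_many_quotients {replicate p x @ u @ replicate q y @ v |p q. k \<le> p \<and> l \<le> q}"
proof -
  have "{replicate q y @ v |q. l \<le> q} = powers_from l y \<odot> {v}"
    unfolding language_conc_def powers_from_def by blast
  moreover have "{replicate p x @ u @ replicate q y @ v |p q. k \<le> p \<and> l \<le> q} =
      powers_from k x \<odot> {u} \<odot> {replicate q y @ v |q. l \<le> q}"
    unfolding language_conc_def powers_from_def by blast
  ultimately show ?thesis
    by (simp only: finitely_many_quotients_conc finitely_many_quotients_powers_from
        finitely_many_quotients_singleton)
qed

lemma quotients_nf_even: "finitely_many_quotients {nf_even s p a q |p q. True}"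
  using quotients_two_powers[of "Lc s" "replicate a (La s)" "Ld s" "[]" 0 0]
  by (simp add: nf_even_def)

lemma quotients_nf_mixed: "finitely_many_quotients {nf_mixed s p a m |p. k \<le> p}"
  unfolding nf_mixed_def by (rule quotients_one_power)

lemma quotients_nf_odd: "finitely_many_quotients {nf_odd s p a e q b |p q. True}"
  using quotients_two_powers[of "Lc s" "replicate a (La s) @ replicate e (Ld s) @ [Lt]" "Lc s"
      "replicate b (La s)" 0 0]
  by (simp add: nf_odd_def)

lemma quotients_nf_odd_0: "finitely_many_quotients {nf_odd s p a 0 0 0 |p. True}"
  using quotients_one_power[of "Lc s" "replicate a (La s) @ [Lt]" 0]
  by (simp add: nf_odd_def)

lemma quotients_nf_twist: "finitely_many_quotients {nf_twist s p a e q b |p q. k \<le> p \<and> l \<le> q}"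
  using quotients_two_powers[of "Lc s" "replicate a (La s) @ replicate e (Ld (\<not> s)) @ [Lt]"
      "Lc (\<not> s)" "replicate b (La (\<not> s)) @ [Lt]" k l]
  by (simp add: nf_twist_def)

definition mixed_params :: "(nat \<times> nat) set" where
  "mixed_params = {(a, m). a \<le> 1 \<and> 1 \<le> m \<and> m \<le> 3 \<and> (m = 3 \<longrightarrow> a = 0)}"

definition odd_params :: "(nat \<times> nat \<times> nat) set" where
  "odd_params = {(a, e, b). a + e + b \<le> 1}"

lemma finite_params [simp]: "finite mixed_params" "finite odd_params"
proof -
  have "mixed_params \<subseteq> {..1} \<times> {..3}" "odd_params \<subseteq> {..1} \<times> {..1} \<times> {..1}"
    unfolding mixed_params_def odd_params_def by auto
  then show "finite mixed_params" "finite odd_params" by (auto intro: finite_subset)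
qed

lemma quotients_minlen_nf: "finitely_many_quotients minlen_nf"
proof -
  \<comment> \<open>All parameters but \<open>p\<close> and \<open>q\<close> have finitely many
    values and index a finite union. Once \<open>b\<close> is fixed, \<open>2 \<le> q + b\<close>
    becomes a lower bound on \<open>q\<close> alone.\<close>
  have eq: "minlen_nf =
    (\<Union>(s, a)\<in>UNIV \<times> {..1}. {nf_even s p a q |p q. True}) \<union>
    (\<Union>(s, a, m)\<in>UNIV \<times> mixed_params. {nf_mixed s p a m |p. m \<le> p}) \<union>
    (\<Union>(s, a, e, b)\<in>UNIV \<times> odd_params. {nf_odd s p a e q b |p q. True}) \<union>
    (\<Union>(s, a, e, b)\<in>UNIV \<times> odd_params. {nf_twist s p a e q b |p q. 1 + e \<le> p \<and> 2 - b \<le> q})"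
    (is "_ = ?E \<union> ?M \<union> ?O \<union> ?T")
  proof -
    have "{nf_even s p a q |s p a q. a \<le> 1} = ?E" by fastforce
    moreover have "{nf_mixed s p a m |s p a m. a \<le> 1 \<and> 1 \<le> m \<and> m \<le> 3 \<and> (m = 3 \<longrightarrow> a = 0) \<and> m \<le> p} =
        ?M"
      unfolding mixed_params_def by fastforce
    moreover have "{nf_odd s p a e q b |s p a e q b. a + e + b \<le> 1} = ?O"
      unfolding odd_params_def by fastforce
    moreover have "{nf_twist s p a e q b |s p a e q b. a + e + b \<le> 1 \<and> 1 + e \<le> p \<and> 2 \<le> q + b} = ?T"
      unfolding odd_params_def le_diff_conv by fastforce
    ultimately show ?thesis unfolding minlen_nf_def by simp
  qed
  show ?thesis unfolding eq
    by (intro finitely_many_quotients_union finitely_many_quotients_UN)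
      (auto simp: quotients_nf_even[simplified] quotients_nf_mixed quotients_nf_odd[simplified]
        quotients_nf_twist)
qed

lemma quotients_class_nf: "finitely_many_quotients class_nf"
proof -
  have eq: "class_nf =
    (\<Union>(s, a)\<in>UNIV \<times> {..1}. {nf_even s p a q |p q. True}) \<union>
    (\<Union>(a, m)\<in>mixed_params. {nf_mixed True p a m |p. m \<le> p}) \<union>
    (\<Union>a\<in>{..1}. {nf_mixed False p a 1 |p. 2 - a \<le> p}) \<union>
    (\<Union>(s, a)\<in>UNIV \<times> {..1}. {nf_odd s p a 0 0 0 |p. True}) \<union>
    (\<Union>(a, e, b)\<in>odd_params. {nf_twist True p a e q b |p q. 1 + e \<le> p \<and> 2 - b \<le> q})"
    (is "_ = ?E \<union> ?M \<union> ?N \<union> ?O \<union> ?T")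
  proof -
    have "{nf_even s p a q |s p a q. a \<le> 1} = ?E" by fastforce
    moreover have "{nf_mixed True p a m |p a m. a \<le> 1 \<and> 1 \<le> m \<and> m \<le> 3 \<and> (m = 3 \<longrightarrow> a = 0) \<and> m \<le> p} =
        ?M"
      unfolding mixed_params_def by fastforce
    \<comment> \<open>As \<open>a \<le> 1\<close>, the single bound \<open>2 - a\<close> also covers
      \<open>1 \<le> p\<close>.\<close>
    moreover have "(a \<le> 1 \<and> 1 \<le> p \<and> 2 \<le> p + a) = (a \<le> 1 \<and> 2 - a \<le> p)" for a p :: nat by auto
    then have "{nf_mixed False p a 1 |p a. a \<le> 1 \<and> 1 \<le> p \<and> 2 \<le> p + a} = ?N"
      by fastforce
    moreover have "{nf_odd s p a 0 0 0 |s p a. a \<le> 1} = ?O" by fastforce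
    moreover have "{nf_twist True p a e q b |p a e q b. a + e + b \<le> 1 \<and> 1 + e \<le> p \<and> 2 \<le> q + b} = ?T"
      unfolding odd_params_def le_diff_conv by fastforce
    ultimately show ?thesis unfolding class_nf_def by simp
  qed
  show ?thesis unfolding eq
    by (intro finitely_many_quotients_union finitely_many_quotients_UN)
      (auto simp: quotients_nf_even[simplified] quotients_nf_mixed[where m = 1, simplified]
        quotients_nf_mixed quotients_nf_odd_0[simplified] quotients_nf_twist)
qed

section \<open>Recognising conjugacy geodesics by capped counts\<close>

definition letters :: "letter list" where
  "letters = [La True, La False, Lc True, Lc False, Ld True, Ld False]"

text \<open>Every count in the definition of \<open>conj_geo\<close> is compared with a constant at most 4, except
  for the bound of one count by another one that is itself at most 3.\<close>

definition conj_geo_state :: "letter list \<Rightarrow> bool \<times> nat \<times> (bool \<Rightarrow> letter \<Rightarrow> nat)" where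
  "conj_geo_state w = (even (count_list w Lt), min 3 (count_list w Lt), \<lambda>p x. if x =
      Lt then 0 else min 4 (seg_count p x w))"

lemma finite_range_conj_geo_state: "finite (range conj_geo_state)"
proof -
  have fin: "finite (UNIV :: letter set)"
  proof -
    have "x \<in> insert Lt (set letters)" for x by (cases x) (auto simp: letters_def)
    then have "(UNIV :: letter set) \<subseteq> insert Lt (set letters)" by blast
    then show ?thesis by (rule finite_subset) simp
  qed
  have 1: "finite {f :: letter \<Rightarrow> nat. \<forall>x. f x \<in> {..4}}"
    using finite_set_of_finite_funs[OF fin, of "{..4::nat}" 0] by simp
  have "finite {f :: bool \<Rightarrow> letter \<Rightarrow> nat. \<forall>p. f p \<in> {g. \<forall>x. g x \<in> {..4}}}"
    using finite_set_of_finite_funs[OF finite_UNIV 1, of undefined] by simp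
  then have "finite (UNIV \<times> {..3::nat} \<times> {f :: bool \<Rightarrow> letter \<Rightarrow> nat. \<forall>p. f p \<in>
      {g. \<forall>x. g x \<in> {..4}}} ::
    (bool \<times> nat \<times> (bool \<Rightarrow> letter \<Rightarrow> nat)) set)"
    by simp
  moreover have "range conj_geo_state \<subseteq> UNIV \<times> {..3} \<times> {f. \<forall>p. f p \<in> {g. \<forall>x. g x \<in> {..4}}}"
    unfolding conj_geo_state_def by auto
  ultimately show ?thesis by (rule rev_finite_subset)
qed

text \<open>The equality of truth values keeps \<open>p\<close> if \<open>u\<close> has an even
  number of letters t and negates it otherwise.\<close>

lemma seg_count_append_parity:
  "seg_count p x (u @ v) = seg_count p x u + seg_count (p = even (count_list u Lt)) x v"
proof (induction u arbitrary: p)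
  case (Cons y u)
  then show ?case by (cases p; cases "even (count_list u Lt)") auto
qed simp

lemma min_add_cong:
  fixes a b c k :: nat
  shows "min k a = min k b \<Longrightarrow> min k (a + c) = min k (b + c)"
  by auto

lemma conj_geo_state_append:
  assumes "conj_geo_state u = conj_geo_state v"
  shows "conj_geo_state (u @ w) = conj_geo_state (v @ w)"
proof -
  have par: "even (count_list u Lt) = even (count_list v Lt)"
    and T: "min 3 (count_list u Lt) = min 3 (count_list v Lt)"
    using assms by (simp_all add: conj_geo_state_def)
  have c: "min 4 (seg_count p x u) = min 4 (seg_count p x v)" if "x \<noteq> Lt" for p x
    using assms that unfolding conj_geo_state_def prod.inject fun_eq_iff by metis
  have "min 4 (seg_count p x (u @ w)) = min 4 (seg_count p x (v @ w))" if "x \<noteq> Lt" for p x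
    unfolding seg_count_append_parity par by (rule min_add_cong) (rule c[OF that])
  then show ?thesis
    using par min_add_cong[OF T] unfolding conj_geo_state_def by (auto simp: fun_eq_iff)
qed

lemma conj_geo_if_conj_geo_state_eq:
  assumes "conj_geo_state u = conj_geo_state v" "conj_geo u"
  shows "conj_geo v"
proof -
  have T: "min 3 (count_list u Lt) = min 3 (count_list v Lt)"
    using assms by (simp_all add: conj_geo_state_def)
  have c: "min 4 (seg_count p x u) = min 4 (seg_count p x v)" if "x \<noteq> Lt" for p x
    using assms(1) that unfolding conj_geo_state_def prod.inject fun_eq_iff by metis
  have small: "seg_count p x v = n" if "seg_count p x u = n" "n < 4" "x \<noteq> Lt" for p x n
    using c[OF that(3), of p] that by auto
  have big: "n \<le> seg_count p x v" if "n \<le> seg_count p x u" "n \<le> 4" "x \<noteq> Lt" for p x n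
    using c[OF that(3), of p] that by auto
  have T': "count_list v Lt = n" if "count_list u Lt = n" "n < 3" for n
    using T that by auto
  have sum: "count_list v x = n" if "count_list u x = n" "n < 4" "x \<noteq> Lt" for x n
  proof -
    have "seg_count True x u < 4" "seg_count False x u < 4"
        using seg_count_sum[OF that(3), of u] that by auto
    then show ?thesis using seg_count_sum[OF that(3), of u] seg_count_sum[OF that(3), of v] small
        that by metis
  qed
  have sum_big: "n \<le> count_list v x" if "n \<le> count_list u x" "n \<le> 4" "x \<noteq> Lt" for x n
    using c[OF that(3), of True] c[OF that(3), of False] that seg_count_sum[OF that(3), of u]
      seg_count_sum[OF that(3), of v] by linarith
  obtain s where "conj_geo_even s u \<or> conj_geo_mixed s u \<or> conj_geo_odd s u \<or> conj_geo_twist s u"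
    using assms(2) unfolding conj_geo_def by blast
  then consider "conj_geo_even s u" | "conj_geo_mixed s u" | "conj_geo_odd s u" |
      "conj_geo_twist s u" by blast
  then show "conj_geo v"
  proof cases
    case 1
    then have "conj_geo_even s v" unfolding conj_geo_even_def by (auto simp: T' sum)
    then show ?thesis unfolding conj_geo_def by blast
  next
    case 2
    then have "conj_geo_mixed s v" unfolding conj_geo_mixed_def by (auto simp: T' sum sum_big)
    then show ?thesis unfolding conj_geo_def by blast
  next
    case 3
    then have "conj_geo_odd s v" unfolding conj_geo_odd_def by (auto simp: T' sum)
    then show ?thesis unfolding conj_geo_def by blast
  next
    case 4
    then have "count_list u (Ld s) < 4" "count_list u (Ld (\<not> s)) < 4"
      "seg_count True (La s) u < 4" "seg_count False (La (\<not> s)) u < 4"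
      unfolding conj_geo_twist_def by auto
    then have "count_list v (Ld s) = count_list u (Ld s)"
        "count_list v (Ld (\<not> s)) = count_list u (Ld (\<not> s))"
      "seg_count True (La s) v = seg_count True (La s) u"
          "seg_count False (La (\<not> s)) v = seg_count False (La (\<not> s)) u"
      by (simp_all add: sum small)
    then have "conj_geo_twist s v" using 4 unfolding conj_geo_twist_def
        by (auto simp: T' small intro: big)
    then show ?thesis unfolding conj_geo_def by blast
  qed
qed

lemma quotients_conj_geo: "finitely_many_quotients {w. conj_geo w}"
  by (rule finitely_many_quotients_state[OF finite_range_conj_geo_state])
    (use conj_geo_if_conj_geo_state_eq conj_geo_state_append in blast)

section \<open>The words that no finite automaton can sort out\<close>

abbreviation blocks :: "nat \<Rightarrow> nat \<Rightarrow> letter list" where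
  "blocks i j \<equiv> replicate i (Lc True) @ [Lt] @ replicate j (Lc True) @ [Lt]"

lemma val_blocks: "val (blocks i j) = ((2 * int i, 2 * int j), 0)"
  by (auto simp: val_def)

text \<open>The bound for words without t is 3j - i here, which exceeds i + j + 2 by 2(j - i -
  1).\<close>

lemma elt_len_blocks:
  assumes "i + 2 \<le> j"
  shows "int (i + j + 2) \<le> elt_len (val (blocks i j))"
proof -
  have "half (2 * int i + 2 * int j) = int i + int j" "half (2 * int i - 2 * int j) = int j - int i"
    using assms unfolding half_def by auto
  then show ?thesis using assms unfolding val_blocks by (auto simp: spread_def)
qed

lemma blocks_geodesic: "i + 2 \<le> j \<Longrightarrow> val v = val (blocks i j) \<Longrightarrow> length (blocks i j) \<le> length v"
  using elt_len_blocks[of i j] elt_len_val_le[of v] by auto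

lemma blocks_not_geodesic:
  assumes "j \<le> i"
  shows "\<exists>v. val v = val (blocks i j) \<and> length v < length (blocks i j)"
proof (intro exI conjI)
  show "val (nf_even True (i - j) 0 (2 * j)) = val (blocks i j)"
    unfolding val_blocks val_nf using assms by auto
  show "length (nf_even True (i - j) 0 (2 * j)) < length (blocks i j)"
    unfolding length_nf using assms by auto
qed

text \<open>Twice the length of the least word exceeds the sum 2i + 2j of its coordinates by exactly
  4, and two letters t use this up. Only positive c and d remain besides, and a pair of letters d
  can be exchanged for letters c.\<close>

lemma least_blocks:
  assumes "i + 2 \<le> j"
  shows "least (blocks i j)"
proof -
  obtain y where y: "least_in (same_val (blocks i j)) y"
      using ex_least_in[of "same_val (blocks i j)"] by blast
  then have val: "val y = val (blocks i j)" by (simp add: least_in_def)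
  have least: "least y" using y val by simp
  have len: "length y = i + j + 2"
    using length_le_if_least_in[OF y, of "blocks i j"] blocks_geodesic[OF assms val] by simp
  have coord: "coord True True y = 2 * int i" "coord True False y = 2 * int j"
      "int (count_list y Lt) mod 2 = 0"
    using val_eq_coord[of y True] val unfolding val_blocks by auto
  have "even (count_list y Lt)" using coord(3) by presburger
  have defect: "2 * int (count_list y Lt) + int (seg_count True (La True) y) +
      int (seg_count False (La True) y)
    + 3 * int (seg_count True (La False) y) + 3 * int (seg_count False (La False) y)
    + 4 * int (seg_count True (Lc False) y) + 4 * int (seg_count False (Lc False) y) +
        4 * int (count_list y (Ld False)) = 4"
    using coord(1,2) len length_eq_seg_count[of y True] unfolding coord_def by simp
  \<comment> \<open>Without t the second coordinate 2j comes from letters d only, and the word would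
    have at least 3j - i letters, too many since i + 2 <= j.\<close>
  have T0: "count_list y Lt \<noteq> 0"
  proof
    assume 0: "count_list y Lt = 0"
    note [simp] = seg_count_False_0[OF 0]
    show False using defect coord(1,2) assms unfolding coord_def 0 by auto
  qed
  have "count_list y Lt \<le> 2" using defect by auto
  with \<open>even (count_list y Lt)\<close> T0 have T: "count_list y Lt = 2"
    by (metis One_nat_def Suc_1 le_SucE le_zero_eq odd_one)
  obtain u v r where w: "y = u @ Lt # v @ Lt # r" and uv: "Lt \<notin> set u" "Lt \<notin> set v" "Lt \<notin> set r"
    using split_two_Lt[OF T] .
  have "r = []" using least_no_tail[of u v r] least w uv by simp
  define p e where "p = count_list u (Lc True)" "e = count_list u (Ld True)"
  define q f where "q = count_list v (Lc True)" "f = count_list v (Ld True)"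
  note defs = p_e_def q_f_def
  have z: "count_list u (La True) = 0" "count_list u (La False) = 0" "count_list u (Lc False) = 0"
      "count_list u (Ld False) = 0"
    "count_list v (La True) = 0" "count_list v (La False) = 0" "count_list v (Lc False) = 0"
        "count_list v (Ld False) = 0"
    using defect T uv(1,2) unfolding w \<open>r = []\<close> by (simp_all add: seg_count_append)
  have "sorted (map rank u)" using least_sorted[of "[]" u "Lt # v @ [Lt]"] least w uv(1) \<open>r = []\<close>
      by simp
  then have u: "u = replicate p (Lc True) @ replicate e (Ld True)"
    using sorted_segment[of u True] uv(1) z by (simp add: defs)
  have "sorted (map rank v)" using least_sorted[of "u @ [Lt]" v "[Lt]"] least w uv(2) \<open>r = []\<close>
      by simp
  then have v: "v = replicate q (Lc True) @ replicate f (Ld True)"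
    using sorted_segment[of v True] uv(2) z by (simp add: defs)
  have w': "y = replicate p (Lc True) @ replicate e (Ld True) @ Lt # replicate q (Lc True) @
      replicate f (Ld True) @ [Lt]"
    using w u v \<open>r = []\<close> by simp
  have pq: "2 * p + e + f = 2 * i" "2 * q + e + f = 2 * j"
    using val unfolding val_blocks w' val_def by auto
  have "e + f \<le> 1"
  proof (rule ccontr)
    assume "\<not> e + f \<le> 1"
    then obtain k where k: "e + f = k + 2"
      by (metis One_nat_def add.commute le_Suc_ex not_less_eq_eq numeral_2_eq_2)
    then have k': "int e = int k + 2 - int f" by linarith
    show False
      by (rule least_not_more_c[OF least w', of "replicate k (Ld True) @ Lt #
          replicate (Suc q) (Lc True) @ [Lt]"])
        (use k k' hd_not_c[of 0 True e True 0] in \<open>auto simp: w' val_def algebra_simps\<close>)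
  qed
  \<comment> \<open>By \<open>pq\<close> the number e + f is even, hence 0.\<close>
  with pq have "e = 0" "f = 0" "p = i" "q = j" by presburger+
  then show ?thesis using w' least by simp
qed

section \<open>Presentations and the semidirect product\<close>

definition eval_word :: "('g, 'm) monoid_scheme \<Rightarrow> ('x \<Rightarrow> 'g) \<Rightarrow> 'x gword \<Rightarrow> 'g" where
  "eval_word H f w = foldr (\<lambda>(x, e) g. (if e then f x else inv\<^bsub>H\<^esub> f x) \<otimes>\<^bsub>H\<^esub> g) w \<one>\<^bsub>H\<^esub>"

context
  fixes H :: "('g, 'm) monoid_scheme" and f :: "'x \<Rightarrow> 'g"
  assumes H: "group H" and f: "\<And>x. f x \<in> carrier H"
begin

interpretation group H by (rule H)

lemma eval_word_Nil [simp]: "eval_word H f [] = \<one>\<^bsub>H\<^esub>"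
  and eval_word_Cons [simp]:
    "eval_word H f ((x, e) # w) = (if e then f x else inv\<^bsub>H\<^esub> f x) \<otimes>\<^bsub>H\<^esub> eval_word H f w"
  by (simp_all add: eval_word_def)

lemma eval_word_closed [simp]: "eval_word H f w \<in> carrier H"
  by (induction w) (auto simp: f)

lemma eval_word_append: "eval_word H f (u @ v) = eval_word H f u \<otimes>\<^bsub>H\<^esub> eval_word H f v"
  by (induction u) (auto simp: f m_assoc)

lemma eval_word_sound:
  assumes "\<And>u v. (u, v) \<in> R \<Longrightarrow> eval_word H f u = eval_word H f v" and "word_eq R u v"
  shows "eval_word H f u = eval_word H f v"
  using assms(2)
proof (induction rule: word_eq.induct)
  case (cancel p x e q)
  have "eval_word H f [(x, e), (x, \<not> e)] = \<one>\<^bsub>H\<^esub>" using f by simp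
  then show ?case unfolding eval_word_append by simp
next
  case (relation u v p q)
  then show ?case unfolding eval_word_append by (simp add: assms(1))
qed auto

lemma generate_subset_eval_word: "generate H (range f) \<subseteq> range (eval_word H f)"
proof
  fix g assume "g \<in> generate H (range f)"
  then show "g \<in> range (eval_word H f)"
  proof induction
    case one
    then show ?case by (rule range_eqI[of _ _ "[]"]) simp
  next
    case (incl h)
    then obtain x where "h = f x" by blast
    then show ?case by (intro range_eqI[of _ _ "[pos x]"]) (simp add: f)
  next
    case (inv h)
    then obtain x where "h = f x" by blast
    then show ?case by (intro range_eqI[of _ _ "[neg x]"]) (simp add: f)
  next
    case (eng g h)
    then obtain u v where "g = eval_word H f u" "h = eval_word H f v" by blast
    then show ?case by (intro range_eqI[of _ _ "u @ v"]) (simp add: eval_word_append)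
  qed
qed

text \<open>The homomorphism \<open>\<theta>\<close> witnesses that the relations suffice: it sends the value of a word
  back to the class of that word.\<close>

lemma has_presentationI:
  assumes rel: "\<And>u v. (u, v) \<in> R \<Longrightarrow> eval_word H f u = eval_word H f v"
    and \<theta>: "\<theta> \<in> hom H (presented_group R)" "\<And>x. \<theta> (f x) = word_class R [pos x]"
    and gen: "carrier H \<subseteq> generate H (range f)"
  shows "has_presentation H f R"
proof -
  interpret P: group "presented_group R" by (rule group_presented_group)
  interpret \<theta>: group_hom H "presented_group R" \<theta>
    using \<theta>(1) by unfold_locales
  have carrier_P: "carrier (presented_group R) = range (word_class R)"
    by (simp add: presented_group_def)
  have one_P: "\<one>\<^bsub>presented_group R\<^esub> = word_class R []"
    by (simp add: presented_group_def)
  have neg: "\<theta> (inv\<^bsub>H\<^esub> f x) = word_class R [neg x]" for x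
  proof -
    have "word_class R [neg x] \<otimes>\<^bsub>presented_group R\<^esub> \<theta> (f x) = \<one>\<^bsub>presented_group R\<^esub>"
      using word_eq.cancel[of R "[]" x False "[]"]
      by (simp add: \<theta>(2) presented_group_mult one_P word_class_eq_iff)
    then have "inv\<^bsub>presented_group R\<^esub> \<theta> (f x) = word_class R [neg x]"
      by (rule P.inv_equality) (auto simp: f carrier_P \<theta>(2))
    then show ?thesis by (simp add: f)
  qed
  have \<theta>_eval: "\<theta> (eval_word H f w) = word_class R w" for w
  proof (induction w)
    case Nil
    then show ?case by (simp add: one_P)
  next
    case (Cons l w)
    obtain x e where l: "l = (x, e)" by (cases l)
    show ?case using Cons
      by (cases e) (simp_all add: l f \<theta>(2) neg presented_group_mult)
  qed
  have carrier_H: "carrier H = range (eval_word H f)"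
    using gen generate_subset_eval_word by auto
  have "inj_on \<theta> (carrier H)"
    unfolding carrier_H
    by (auto intro!: inj_onI simp: \<theta>_eval word_class_eq_iff eval_word_sound[OF rel])
  moreover have "\<theta> ` carrier H = carrier (presented_group R)"
    unfolding carrier_H carrier_P image_image \<theta>_eval ..
  ultimately have "\<theta> \<in> iso H (presented_group R)"
    using \<theta>(1) by (simp add: iso_def bij_betw_def)
  then have "inv_into (carrier H) \<theta> \<in> iso (presented_group R) H"
    by (rule iso_set_sym)
  moreover have "inv_into (carrier H) \<theta> (word_class R [pos x]) = f x" for x
    using \<open>inj_on \<theta> (carrier H)\<close> f by (metis \<theta>(2) inv_into_f_f)
  ultimately show ?thesis unfolding has_presentation_def by blast
qed

end

lemma has_presentation_iso:
  assumes "has_presentation H f R" "\<psi> \<in> iso H G"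
  shows "has_presentation G (\<lambda>x. \<psi> (f x)) R"
proof -
  obtain \<phi> where "\<phi> \<in> iso (presented_group R) H" "\<And>x. \<phi> (word_class R [pos x]) = f x"
    using assms(1) unfolding has_presentation_def by blast
  then have "\<psi> \<circ> \<phi> \<in> iso (presented_group R) G" "\<And>x. (\<psi> \<circ> \<phi>) (word_class R [pos x]) = \<psi> (f x)"
    using assms(2) by (auto intro: iso_set_trans)
  then show ?thesis unfolding has_presentation_def by blast
qed

lemma iso_if_has_presentation:
  assumes "has_presentation H f R" "has_presentation G g R"
  obtains \<psi> where "\<psi> \<in> iso H G" "\<And>x. \<psi> (f x) = g x"
proof -
  obtain \<phi> where \<phi>: "\<phi> \<in> iso (presented_group R) H" "\<And>x. \<phi> (word_class R [pos x]) = f x"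
    using assms(1) unfolding has_presentation_def by blast
  obtain \<chi> where \<chi>: "\<chi> \<in> iso (presented_group R) G" "\<And>x. \<chi> (word_class R [pos x]) = g x"
    using assms(2) unfolding has_presentation_def by blast
  let ?i = "inv_into (carrier (presented_group R)) \<phi>"
  have "?i \<in> iso H (presented_group R)"
    using group.iso_set_sym[OF group_presented_group \<phi>(1)] .
  then have "\<chi> \<circ> ?i \<in> iso H G" using \<chi>(1) by (auto intro: iso_set_trans)
  moreover have "(\<chi> \<circ> ?i) (f x) = g x" for x
  proof -
    have "word_class R [pos x] \<in> carrier (presented_group R)" by (simp add: presented_group_def)
    moreover have "inj_on \<phi> (carrier (presented_group R))" using \<phi>(1)
        by (simp add: iso_def bij_betw_def)
    ultimately have "?i (f x) = word_class R [pos x]" using \<phi>(2) by (metis inv_into_f_f)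
    then show ?thesis by (simp add: \<chi>(2))
  qed
  ultimately show ?thesis by (rule that)
qed

section \<open>The semidirect product satisfies both presentations\<close>

abbreviation SD :: "((int \<times> int) \<times> int) monoid" where
  "SD \<equiv> semidirect_product (integer_group \<times>\<times> integer_group) (integer_mod_group 2) swap_action"

lemma carrier_SD: "carrier SD = UNIV \<times> {0, 1}"
  by (auto simp: semidirect_product_def carrier_integer_mod_group)

lemma one_SD [simp]: "\<one>\<^bsub>SD\<^esub> = ((0, 0), 0)"
  by (simp add: semidirect_product_def)

lemma mult_SD [simp]:
  "((i, j), k) \<otimes>\<^bsub>SD\<^esub> ((i', j'), k') =
    ((if k = 0 then (i + i', j + j') else (i + j', j + i')), (k + k') mod 2)"
  by (simp add: semidirect_product_def swap_action_def mult_DirProd)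

lemma group_SD: "group SD"
proof (rule groupI)
  fix x assume "x \<in> carrier SD"
  then obtain i j k where x: "x = ((i, j), k)" "k = 0 \<or> k = 1" by (auto simp: carrier_SD)
  then have "(if k = 0 then ((- i, - j), k) else ((- j, - i), k)) \<otimes>\<^bsub>SD\<^esub> x = \<one>\<^bsub>SD\<^esub>"
    by auto
  moreover have "(if k = 0 then ((- i, - j), k) else ((- j, - i), k)) \<in> carrier SD"
    using x(2) by (auto simp: carrier_SD)
  ultimately show "\<exists>y\<in>carrier SD. y \<otimes>\<^bsub>SD\<^esub> x = \<one>\<^bsub>SD\<^esub>" by blast
qed (auto simp: carrier_SD)

interpretation SD: group SD by (rule group_SD)

lemma SD_generated:
  assumes "subgroup S SD" "((1, 0), 0) \<in> S" "((0, 1), 0) \<in> S" "((0, 0), 1) \<in> S"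
  shows "carrier SD \<subseteq> S"
proof
  fix x assume "x \<in> carrier SD"
  then obtain i j k where x: "x = ((i, j), k)" "k = 0 \<or> k = 1" by (auto simp: carrier_SD)
  have inv: "((- 1, 0), 0) \<in> S" "((0, - 1), 0) \<in> S"
    using subgroup.m_inv_closed[OF assms(1,2)] subgroup.m_inv_closed[OF assms(1,3)]
      SD.inv_equality[of "((- 1, 0), 0)" "((1, 0), 0)"]
          SD.inv_equality[of "((0, - 1), 0)" "((0, 1), 0)"]
    by (simp_all add: carrier_SD)
  have i: "((i, 0), 0) \<in> S"
  proof (induction i rule: int_induct[of _ 0])
    case base
    then show ?case using subgroup.one_closed[OF assms(1)] by simp
  next
    case (step1 i)
    then show ?case using subgroup.m_closed[OF assms(1) step1(2) assms(2)] by simp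
  next
    case (step2 i)
    then show ?case using subgroup.m_closed[OF assms(1) step2(2) inv(1)] by simp
  qed
  have j: "((0, j), 0) \<in> S"
  proof (induction j rule: int_induct[of _ 0])
    case base
    then show ?case using subgroup.one_closed[OF assms(1)] by simp
  next
    case (step1 i)
    then show ?case using subgroup.m_closed[OF assms(1) step1(2) assms(3)] by simp
  next
    case (step2 i)
    then show ?case using subgroup.m_closed[OF assms(1) step2(2) inv(2)] by simp
  qed
  have "((i, j), 0) \<in> S" using subgroup.m_closed[OF assms(1) i j] by simp
  then show "x \<in> S" using x subgroup.m_closed[OF assms(1) _ assms(4), of "((i, j), 0)"] by auto
qed

text \<open>Conjugation by \<open>x\<close> is an endomorphism that fixes \<open>y\<close>, hence
  also its integer powers.\<close>

lemma (in group) commute_int_pow: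
  assumes [simp]: "x \<in> carrier G" "y \<in> carrier G" and xy: "x \<otimes> y = y \<otimes> x"
  shows "x \<otimes> y [^] (n :: int) = y [^] n \<otimes> x"
proof -
  define d where "d z = x \<otimes> z \<otimes> inv x" for z
  have "d \<in> hom G G"
  proof (rule homI)
    fix u v assume [simp]: "u \<in> carrier G" "v \<in> carrier G"
    have "d u \<otimes> d v = x \<otimes> u \<otimes> (inv x \<otimes> x) \<otimes> v \<otimes> inv x"
      unfolding d_def by (simp only: m_assoc m_closed inv_closed assms \<open>u \<in> carrier G\<close> \<open>v \<in>
          carrier G\<close>)
    then show "d (u \<otimes> v) = d u \<otimes> d v" by (simp add: d_def m_assoc)
  qed (simp add: d_def)
  then interpret d: group_hom G G d by unfold_locales
  have "d y = y" by (simp add: d_def xy m_assoc)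
  then have "d (y [^] n) = y [^] n" by (simp add: d.hom_int_pow)
  then have "x \<otimes> y [^] n \<otimes> inv x \<otimes> x = y [^] n \<otimes> x" by (simp add: d_def)
  then show ?thesis by (simp add: m_assoc)
qed

text \<open>The universal property of the semidirect product. As t is an involution, conjugation by
  it exchanges a and b, which matches \<open>swap_action\<close>. The values at (2, 0) and (1, 1)
  serve the generators c and d.\<close>

lemma (in group) hom_from_SD:
  assumes [simp]: "a \<in> carrier G" "b \<in> carrier G" "t \<in> carrier G"
    and t: "t \<otimes> t = \<one>" and ab: "a \<otimes> b = b \<otimes> a" and at: "inv t \<otimes> a \<otimes> t = b"
  defines "\<theta> \<equiv> \<lambda>((i :: int, j :: int), k :: int). a [^] i \<otimes> b [^] j \<otimes> (if k = 0 then \<one> else t)"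
  shows "\<theta> \<in> hom SD G" and "\<theta> ((1, 0), 0) = a" and "\<theta> ((2, 0), 0) = a \<otimes> a"
    and "\<theta> ((0, 1), 0) = b" and "\<theta> ((1, 1), 0) = a \<otimes> b" and "\<theta> ((0, 0), 1) = t"
proof -
  have inv_t: "inv t = t" using t by (simp add: inv_equality)
  define c where "c x = t \<otimes> x \<otimes> t" for x
  have c_hom: "c \<in> hom G G"
  proof (rule homI)
    fix x y assume [simp]: "x \<in> carrier G" "y \<in> carrier G"
    have "c x \<otimes> c y = t \<otimes> x \<otimes> (t \<otimes> t) \<otimes> y \<otimes> t" unfolding c_def by (simp add: m_assoc)
    then show "c (x \<otimes> y) = c x \<otimes> c y" by (simp add: t c_def m_assoc)
  qed (simp add: c_def)
  have ca: "c a = b" using at by (simp add: c_def inv_t)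
  have "c b = t \<otimes> t \<otimes> a \<otimes> (t \<otimes> t)" unfolding ca[symmetric] c_def by (simp add: m_assoc)
  then have cb: "c b = a" by (simp add: t)
  interpret c: group_hom G G c using c_hom by unfold_locales
  have c_pow: "c (a [^] i) = b [^] i" "c (b [^] i) = a [^] i" for i :: int
    by (simp_all add: c.hom_int_pow ca cb)
  have swap: "t \<otimes> x = c x \<otimes> t" if "x \<in> carrier G" for x
    using that by (simp add: c_def m_assoc t)
  have comm: "b [^] j \<otimes> a [^] i = a [^] i \<otimes> b [^] j" for i j :: int
    by (intro commute_int_pow) (simp_all add: commute_int_pow ab)
  have mult: "a [^] i \<otimes> b [^] j \<otimes> (a [^] i' \<otimes> b [^] j') = a [^] (i + i') \<otimes> b [^] (j + j')" for i
      i' j j' :: int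
  proof -
    have "a [^] i \<otimes> b [^] j \<otimes> (a [^] i' \<otimes> b [^] j') = a [^] i \<otimes> (b [^] j \<otimes> a [^] i') \<otimes> b [^] j'"
      by (simp add: m_assoc)
    also have "\<dots> = (a [^] i \<otimes> a [^] i') \<otimes> (b [^] j \<otimes> b [^] j')"
      by (simp add: comm m_assoc)
    finally show ?thesis by (simp add: int_pow_mult)
  qed
  show "\<theta> \<in> hom SD G"
  proof (rule homI)
    fix x assume "x \<in> carrier SD"
    then show "\<theta> x \<in> carrier G" by (auto simp: carrier_SD \<theta>_def)
  next
    fix x y assume "x \<in> carrier SD" "y \<in> carrier SD"
    then obtain i j k i' j' k' where x: "x = ((i, j), k)" "k = 0 \<or> k = 1"
      and y: "y = ((i', j'), k')" "k' = 0 \<or> k' = 1" by (auto simp: carrier_SD)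
    define t' where "t' = (if k' = 0 then \<one> else t)"
    have [simp]: "t' \<in> carrier G" by (simp add: t'_def)
    show "\<theta> (x \<otimes>\<^bsub>SD\<^esub> y) = \<theta> x \<otimes> \<theta> y"
    proof (cases "k = 0")
      case True
      have "\<theta> x \<otimes> \<theta> y = a [^] i \<otimes> b [^] j \<otimes> (a [^] i' \<otimes> b [^] j') \<otimes> t'"
        unfolding x y \<theta>_def t'_def[symmetric] using True by (simp add: t'_def m_assoc)
      then show ?thesis using x y True by (auto simp: \<theta>_def t'_def mult)
    next
      case False
      have "\<theta> x \<otimes> \<theta> y = a [^] i \<otimes> b [^] j \<otimes> (t \<otimes> (a [^] i' \<otimes> b [^] j')) \<otimes> t'"
        unfolding x y \<theta>_def using False by (simp add: t'_def m_assoc)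
      also have "t \<otimes> (a [^] i' \<otimes> b [^] j') = a [^] j' \<otimes> b [^] i' \<otimes> t"
        by (simp add: swap c_pow comm)
      also have "a [^] i \<otimes> b [^] j \<otimes> (a [^] j' \<otimes> b [^] i' \<otimes> t) \<otimes> t' =
          a [^] i \<otimes> b [^] j \<otimes> (a [^] j' \<otimes> b [^] i') \<otimes> (t \<otimes> t')"
        by (simp add: m_assoc)
      finally show ?thesis using x y False by (auto simp: \<theta>_def t'_def mult t)
    qed
  qed
  have "a [^] (2 :: int) = a \<otimes> a"
    using int_pow_mult[of a 1 1] by simp
  then show "\<theta> ((1, 0), 0) = a" "\<theta> ((2, 0), 0) = a \<otimes> a" "\<theta> ((0, 1), 0) = b"
      "\<theta> ((1, 1), 0) = a \<otimes> b" "\<theta> ((0, 0), 1) = t"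
    by (simp_all add: \<theta>_def)
qed

fun sd_abt :: "gen_abt \<Rightarrow> (int \<times> int) \<times> int" where
  "sd_abt Gen_a = ((1, 0), 0)" | "sd_abt Gen_b = ((0, 1), 0)" | "sd_abt Gen_t = ((0, 0), 1)"

fun sd_acdt :: "gen_acdt \<Rightarrow> (int \<times> int) \<times> int" where
  "sd_acdt Gen'_a = ((1, 0), 0)" | "sd_acdt Gen'_c = ((2, 0), 0)"
| "sd_acdt Gen'_d = ((1, 1), 0)" | "sd_acdt Gen'_t = ((0, 0), 1)"

lemma inv_SD:
  "inv\<^bsub>SD\<^esub> ((i, j), 0) = ((- i, - j), 0)" "inv\<^bsub>SD\<^esub> ((0, 0), 1) = ((0, 0), 1)"
  by (rule SD.inv_equality; simp add: carrier_SD)+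

lemma has_presentation_SD_abt: "has_presentation SD sd_abt relations_abt"
proof -
  let ?P = "presented_group relations_abt" and ?c = "\<lambda>x. word_class relations_abt [pos x]"
  interpret P: group ?P by (rule group_presented_group)
  have closed: "?c x \<in> carrier ?P" for x by (simp add: presented_group_def)
  have one_P: "\<one>\<^bsub>?P\<^esub> = word_class relations_abt []" by (simp add: presented_group_def)
  have rel: "word_class relations_abt u = word_class relations_abt v" if "(u, v) \<in> relations_abt"
      for u v
    using word_eq.relation[OF that, of "[]" "[]"] by (simp add: word_class_eq_iff)
  have tt: "?c Gen_t \<otimes>\<^bsub>?P\<^esub> ?c Gen_t = \<one>\<^bsub>?P\<^esub>"
    unfolding presented_group_mult one_P by (simp, rule rel, simp add: relations_abt_def)
  have ab: "?c Gen_a \<otimes>\<^bsub>?P\<^esub> ?c Gen_b = ?c Gen_b \<otimes>\<^bsub>?P\<^esub> ?c Gen_a"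
    unfolding presented_group_mult one_P by (simp, rule rel, simp add: relations_abt_def)
  have "word_class relations_abt [neg Gen_t] \<otimes>\<^bsub>?P\<^esub> ?c Gen_t = \<one>\<^bsub>?P\<^esub>"
    using word_eq.cancel[of relations_abt "[]" Gen_t False "[]"]
    by (simp add: presented_group_mult one_P word_class_eq_iff)
  then have inv_t: "inv\<^bsub>?P\<^esub> ?c Gen_t = word_class relations_abt [neg Gen_t]"
    by (rule P.inv_equality) (simp_all add: presented_group_def)
  have at: "inv\<^bsub>?P\<^esub> ?c Gen_t \<otimes>\<^bsub>?P\<^esub> ?c Gen_a \<otimes>\<^bsub>?P\<^esub> ?c Gen_t = ?c Gen_b"
    unfolding inv_t presented_group_mult by (simp, rule rel, simp add: relations_abt_def)
  note \<theta> = P.hom_from_SD[OF closed closed closed tt ab at]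
  show ?thesis
  proof (rule has_presentationI[OF group_SD _ _ \<theta>(1)])
    show carrier: "sd_abt x \<in> carrier SD" for x by (cases x) (simp_all add: carrier_SD)
    show "eval_word SD sd_abt u = eval_word SD sd_abt v" if "(u, v) \<in> relations_abt" for u v
      using that by (auto simp: relations_abt_def eval_word_def inv_SD)
    show "(case sd_abt x of (x, k) \<Rightarrow> (case x of (i, j) \<Rightarrow> \<lambda>k. ?c Gen_a [^]\<^bsub>?P\<^esub> i \<otimes>\<^bsub>?P\<^esub>
        ?c Gen_b [^]\<^bsub>?P\<^esub> j \<otimes>\<^bsub>?P\<^esub> (if k = 0 then \<one>\<^bsub>?P\<^esub> else ?c Gen_t)) k) = ?c x" for x
      using \<theta>(2,4,6) by (cases x) simp_all
    have "subgroup (generate SD (range sd_abt)) SD"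
      by (rule SD.generate_is_subgroup) (use carrier in blast)
    moreover have "sd_abt x \<in> generate SD (range sd_abt)" for x by (simp add: generate.incl)
    ultimately show "carrier SD \<subseteq> generate SD (range sd_abt)"
      by (metis SD_generated sd_abt.simps)
  qed
qed

lemma has_presentation_SD_acdt: "has_presentation SD sd_acdt relations_acdt"
proof -
  let ?P = "presented_group relations_acdt" and ?c = "\<lambda>x. word_class relations_acdt [pos x]"
  interpret P: group ?P by (rule group_presented_group)
  have closed [simp]: "?c x \<in> carrier ?P" for x by (simp add: presented_group_def)
  have one_P: "\<one>\<^bsub>?P\<^esub> = word_class relations_acdt []" by (simp add: presented_group_def)
  have rel: "word_class relations_acdt u = word_class relations_acdt v" if
      "(u, v) \<in> relations_acdt" for u v
    using word_eq.relation[OF that, of "[]" "[]"] by (simp add: word_class_eq_iff)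
  have tt: "?c Gen'_t \<otimes>\<^bsub>?P\<^esub> ?c Gen'_t = \<one>\<^bsub>?P\<^esub>"
    unfolding presented_group_mult one_P by (simp, rule rel, simp add: relations_acdt_def)
  have ad: "?c Gen'_a \<otimes>\<^bsub>?P\<^esub> ?c Gen'_d = ?c Gen'_d \<otimes>\<^bsub>?P\<^esub> ?c Gen'_a"
    unfolding presented_group_mult by (simp, rule rel, simp add: relations_acdt_def)
  have c: "?c Gen'_c = ?c Gen'_a \<otimes>\<^bsub>?P\<^esub> ?c Gen'_a"
    unfolding presented_group_mult by (simp, rule rel, simp add: relations_acdt_def)
  have "word_class relations_acdt [neg Gen'_a] \<otimes>\<^bsub>?P\<^esub> ?c Gen'_a = \<one>\<^bsub>?P\<^esub>"
    using word_eq.cancel[of relations_acdt "[]" Gen'_a False "[]"]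
    by (simp add: presented_group_mult one_P word_class_eq_iff)
  then have inv_a: "inv\<^bsub>?P\<^esub> ?c Gen'_a = word_class relations_acdt [neg Gen'_a]"
    by (rule P.inv_equality) (simp_all add: presented_group_def)
  have inv_t: "inv\<^bsub>?P\<^esub> ?c Gen'_t = ?c Gen'_t" using tt by (simp add: P.inv_equality)
  \<comment> \<open>The missing generator b is a^{-1} d; the relation t a t = a^{-1} d then says
    that a^t = b.\<close>
  let ?b = "inv\<^bsub>?P\<^esub> ?c Gen'_a \<otimes>\<^bsub>?P\<^esub> ?c Gen'_d"
  have b: "?b \<in> carrier ?P" by simp
  have at: "inv\<^bsub>?P\<^esub> ?c Gen'_t \<otimes>\<^bsub>?P\<^esub> ?c Gen'_a \<otimes>\<^bsub>?P\<^esub> ?c Gen'_t = ?b"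
    unfolding inv_t unfolding inv_a presented_group_mult
        by (simp, rule rel, simp add: relations_acdt_def)
  have "?c Gen'_a \<otimes>\<^bsub>?P\<^esub> ?b = ?c Gen'_d" by (simp add: P.m_assoc[symmetric])
  moreover have "?b \<otimes>\<^bsub>?P\<^esub> ?c Gen'_a = ?c Gen'_d"
    by (simp add: P.m_assoc ad[symmetric]) (simp add: P.m_assoc[symmetric])
  ultimately have ab: "?c Gen'_a \<otimes>\<^bsub>?P\<^esub> ?b = ?b \<otimes>\<^bsub>?P\<^esub> ?c Gen'_a"
      and d: "?c Gen'_a \<otimes>\<^bsub>?P\<^esub> ?b = ?c Gen'_d"
    by simp_all
  note \<theta> = P.hom_from_SD[OF closed b closed tt ab at]
  show ?thesis
  proof (rule has_presentationI[OF group_SD _ _ \<theta>(1)])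
    show carrier: "sd_acdt x \<in> carrier SD" for x by (cases x) (simp_all add: carrier_SD)
    show "eval_word SD sd_acdt u = eval_word SD sd_acdt v" if "(u, v) \<in> relations_acdt" for u v
      using that by (auto simp: relations_acdt_def eval_word_def inv_SD)
    show "(case sd_acdt x of (x, k) \<Rightarrow> (case x of (i, j) \<Rightarrow> \<lambda>k. ?c Gen'_a [^]\<^bsub>?P\<^esub> i \<otimes>\<^bsub>?P\<^esub>
        ?b [^]\<^bsub>?P\<^esub> j \<otimes>\<^bsub>?P\<^esub> (if k = 0 then \<one>\<^bsub>?P\<^esub> else ?c Gen'_t)) k) = ?c x" for x
      using \<theta>(2,3,5,6) c d by (cases x) simp_all
    have sub: "subgroup (generate SD (range sd_acdt)) SD"
      by (rule SD.generate_is_subgroup) (use carrier in blast)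
    have incl: "sd_acdt x \<in> generate SD (range sd_acdt)" for x by (simp add: generate.incl)
    \<comment> \<open>The element (0, 1) required by \<open>SD_generated\<close> is again a^{-1}
      d.\<close>
    have "inv\<^bsub>SD\<^esub> sd_acdt Gen'_a \<otimes>\<^bsub>SD\<^esub> sd_acdt Gen'_d \<in> generate SD (range sd_acdt)"
      by (intro subgroup.m_closed[OF sub] subgroup.m_inv_closed[OF sub] incl)
    then have "((0, 1), 0) \<in> generate SD (range sd_acdt)" by (simp add: inv_SD)
    then show "carrier SD \<subseteq> generate SD (range sd_acdt)"
      using SD_generated[OF sub] incl[of Gen'_a] incl[of Gen'_t] by simp
  qed
qed

section \<open>Transfer to the group\<close>

fun sd_letter :: "letter \<Rightarrow> elt" where
  "sd_letter (La s) = ((sg s, 0), 0)"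
| "sd_letter (Lc s) = ((2 * sg s, 0), 0)"
| "sd_letter (Ld s) = ((sg s, sg s), 0)"
| "sd_letter Lt = ((0, 0), 1)"

lemma inj_sd_letter: "inj sd_letter"
proof (rule injI)
  fix x y assume "sd_letter x = sd_letter y"
  then show "x = y" by (cases x; cases y) (auto split: if_splits)
qed

lemma sd_letter_closed: "sd_letter x \<in> carrier SD"
  by (cases x) (auto simp: carrier_SD)

lemma val_closed: "val w \<in> carrier SD"
  using snd_val[of w] by (cases "val w") (auto simp: carrier_SD)

lemma act_eq_mult: "g \<in> carrier SD \<Longrightarrow> act x g = sd_letter x \<otimes>\<^bsub>SD\<^esub> g"
  by (cases x) (auto simp: carrier_SD)

lemma ex_val:
  assumes "g \<in> carrier SD"
  shows "\<exists>w. val w = g"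
proof -
  obtain i j k where g: "g = ((i, j), k)" "k = 0 \<or> k = 1" using assms by (auto simp: carrier_SD)
  have "val (replicate (nat \<bar>i\<bar>) (La (0 \<le> i)) @ [Lt] @ replicate (nat \<bar>j\<bar>) (La (0 \<le> j))
      @ (if k = 0 then [Lt] else [])) = g"
    using g(2) by (auto simp: g(1) val_def)
  then show ?thesis by blast
qed

lemma conj_class_SD:
  assumes "g \<in> carrier SD"
  shows "conj_class SD g = {h. conj_rel g h}"
proof -
  obtain i j k where g: "g = ((i, j), k)" "k = 0 \<or> k = 1" using assms by (auto simp: carrier_SD)
  \<comment> \<open>In this form conjugacy is decided by products alone, without computing
    inverses.\<close>
  have eq: "inv\<^bsub>SD\<^esub> x \<otimes>\<^bsub>SD\<^esub> g \<otimes>\<^bsub>SD\<^esub> x = h \<longleftrightarrow> g \<otimes>\<^bsub>SD\<^esub> x = x \<otimes>\<^bsub>SD\<^esub> h"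
    if "x \<in> carrier SD" "h \<in> carrier SD" for x h
    using that assms by (metis SD.inv_closed SD.inv_solve_left SD.m_assoc SD.m_closed)
  have "h \<in> carrier SD" if "conj_rel g h" for h
    using that g by (cases h; cases "fst h") (auto simp: carrier_SD)
  moreover have "h \<in> carrier SD" if "h \<in> conj_class SD g" for h
    using that assms unfolding conj_class_def by auto
  moreover have "h \<in> conj_class SD g \<longleftrightarrow> conj_rel g h" if h: "h \<in> carrier SD" for h
  proof -
    obtain i' j' k' where h': "h = ((i', j'), k')" "k' = 0 \<or> k' = 1" using h
        by (auto simp: carrier_SD)
    have "h \<in> conj_class SD g \<longleftrightarrow> (\<exists>x\<in>carrier SD. g \<otimes>\<^bsub>SD\<^esub> x = x \<otimes>\<^bsub>SD\<^esub> h)"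
      using eq h unfolding conj_class_def by blast
    also have "\<dots> \<longleftrightarrow> conj_rel g h"
    proof
      assume "\<exists>x\<in>carrier SD. g \<otimes>\<^bsub>SD\<^esub> x = x \<otimes>\<^bsub>SD\<^esub> h"
      then obtain m n l where "l = 0 \<or> l = 1" "g \<otimes>\<^bsub>SD\<^esub> ((m, n), l) = ((m, n), l) \<otimes>\<^bsub>SD\<^esub> h"
        by (auto simp: carrier_SD)
      then show "conj_rel g h" using g(2) h'(2) unfolding g h' by (auto split: if_splits)
    next
      assume rel: "conj_rel g h"
      show "\<exists>x\<in>carrier SD. g \<otimes>\<^bsub>SD\<^esub> x = x \<otimes>\<^bsub>SD\<^esub> h"
      proof (cases "k = 0")
        case True
        then consider "h = g" | "h = ((j, i), k)" using rel unfolding g h' by auto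
        then show ?thesis
        proof cases
          case 1
          then show ?thesis using True unfolding g
            by (intro bexI[of _ "((0, 0), 0)"]) (auto simp: carrier_SD)
        next
          case 2
          then show ?thesis using True unfolding g
            by (intro bexI[of _ "((0, 0), 1)"]) (auto simp: carrier_SD)
        qed
      next
        case False
        \<comment> \<open>Conjugation by a translation shifts an amount from one coordinate to the
          other.\<close>
        then show ?thesis using rel unfolding g h'
          by (intro bexI[of _ "((i - i', 0), 0)"]) (auto simp: carrier_SD)
      qed
    qed
    finally show ?thesis .
  qed
  ultimately show ?thesis by blast
qed

lemma conj_class_iso:
  assumes "group H" "group G" "\<psi> \<in> iso H G" "g \<in> carrier H"
  shows "conj_class G (\<psi> g) = \<psi> ` conj_class H g"
proof -
  interpret group_hom H G \<psi>
    using assms(1-3) by (simp add: group_hom_def group_hom_axioms_def iso_def)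
  have "carrier G = \<psi> ` carrier H" using assms(3) by (simp add: iso_def bij_betw_def)
  then show ?thesis
    unfolding conj_class_def Setcompr_eq_image using assms(4) by (simp add: image_image)
qed

lemma lenlex_map:
  assumes "\<And>x y. (g x, g y) \<in> r \<longleftrightarrow> (x, y) \<in> s" "inj g"
  shows "(map g u, map g v) \<in> lenlex r \<longleftrightarrow> (u, v) \<in> lenlex s"
proof (induction u arbitrary: v)
  case Nil
  then show ?case by (cases v) auto
next
  case (Cons x u)
  then show ?case using assms by (cases v) (auto simp: Cons_lenlex_iff inj_eq)
qed

text \<open>Results on words over the abstract letters are carried along \<open>\<psi>\<close> to
  any group isomorphic to the semidirect product, with the images of the letters as
  generators.\<close>

locale sd_iso =
  fixes G :: "('g, 'm) monoid_scheme" and \<psi> :: "elt \<Rightarrow> 'g"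
  assumes G: "group G" and \<psi>: "\<psi> \<in> iso SD G"
begin

interpretation \<psi>: group_hom SD G \<psi>
  using group_SD G \<psi> by (simp add: group_hom_def group_hom_axioms_def iso_def)

definition gen :: "letter \<Rightarrow> 'g" where
  "gen x = \<psi> (sd_letter x)"

definition X :: "'g set" where
  "X = range gen"

definition gen_order :: "'g rel" where
  "gen_order = {(gen x, gen y) |x y. (x, y) \<in> letter_order}"

lemma inj_\<psi>: "inj_on \<psi> (carrier SD)"
  using \<psi> by (simp add: iso_def bij_betw_def)

lemma carrier_G: "carrier G = \<psi> ` carrier SD"
  using \<psi> by (simp add: iso_def bij_betw_def)

lemma inj_gen: "inj gen"
  using inj_sd_letter inj_\<psi> sd_letter_closed by (auto simp: gen_def inj_on_def)

lemma word_val_gen: "word_val G (map gen w) = \<psi> (val w)"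
proof (induction w)
  case Nil
  then show ?case using \<psi>.hom_one by (simp add: word_val_def)
next
  case (Cons x w)
  then show ?case
    by (simp add: word_val_def gen_def act_eq_mult val_closed sd_letter_closed)
qed

lemma word_val_eq_iff: "g \<in> carrier SD \<Longrightarrow> word_val G (map gen w) = \<psi> g \<longleftrightarrow> val w = g"
  using inj_\<psi> val_closed by (auto simp: word_val_gen inj_on_def)

lemma lists_X: "lists X = range (map gen)"
  unfolding X_def by (metis lists_UNIV lists_image)

lemma words_of_elt:
  "g \<in> carrier SD \<Longrightarrow> {w \<in> lists X. word_val G w = \<psi> g} = map gen ` {w. val w = g}"
  unfolding lists_X using word_val_eq_iff by blast

lemma words_of_class:
  assumes "g \<in> carrier SD"
  shows "{w \<in> lists X. word_val G w \<in> conj_class G (\<psi> g)} = map gen ` {w. conj_rel g (val w)}"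
proof -
  have "\<psi> (val w) \<in> \<psi> ` conj_class SD g \<longleftrightarrow> val w \<in> conj_class SD g" for w
  proof (rule inj_on_image_mem_iff[OF inj_\<psi> val_closed])
    show "conj_class SD g \<subseteq> carrier SD" using assms unfolding conj_class_def by auto
  qed
  moreover have "{w \<in> lists X. word_val G w \<in> K} = map gen ` {w. \<psi> (val w) \<in> K}" for K
    unfolding lists_X word_val_gen[symmetric] by blast
  ultimately show ?thesis
    by (simp only: conj_class_iso[OF group_SD G \<psi> assms] conj_class_SD[OF assms] mem_Collect_eq)
qed

lemma elt_length_le: "elt_length G X (\<psi> (val w)) \<le> length w"
  unfolding elt_length_def
  by (rule Least_le) (use word_val_gen lists_X in \<open>auto intro!: bexI[of _ "map gen w"]\<close>)

lemma elt_length_attained: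
  assumes "g \<in> carrier SD"
  shows "\<exists>w. val w = g \<and> length w = elt_length G X (\<psi> g)"
proof -
  obtain v where "val v = g" using ex_val[OF assms] by blast
  then have "\<exists>n. \<exists>w\<in>lists X. word_val G w = \<psi> g \<and> length w = n"
    using word_val_gen lists_X by (metis rangeI)
  then have "\<exists>w\<in>lists X. word_val G w = \<psi> g \<and> length w = elt_length G X (\<psi> g)"
    unfolding elt_length_def by (rule LeastI_ex)
  then show ?thesis using word_val_eq_iff[OF assms] by (auto simp: lists_X)
qed

text \<open>Since \<open>conj_len\<close> is constant on conjugacy classes, the lower bound holds
  for each conjugate, and a word from \<open>ex_conj_geo\<close> attains it.\<close>

lemma conj_length_eq:
  assumes "g \<in> carrier SD"
  shows "int (conj_length G X (\<psi> g)) = conj_len g"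
proof -
  have cls: "conj_class G (\<psi> g) = \<psi> ` {h. conj_rel g h}"
    by (simp add: conj_class_iso[OF group_SD G \<psi> assms] conj_class_SD[OF assms])
  have closed: "h \<in> carrier SD" if "conj_rel g h" for h
    using that assms by (cases h; cases "fst h") (auto simp: carrier_SD)
  have lower: "conj_len g \<le> int (elt_length G X (\<psi> h))" if "conj_rel g h" for h
    using elt_length_attained[OF closed[OF that]] conj_len_val_le conj_len_conj_rel[OF that]
        by metis
  have "snd g \<in> {0, 1}" using assms by (auto simp: carrier_SD)
  then obtain w where w: "conj_geo w" "conj_rel g (val w)" using ex_conj_geo by blast
  then have len: "int (length w) = conj_len g" using conj_len_eq_iff_conj_geo conj_len_conj_rel
      by metis
  have "conj_length G X (\<psi> g) = elt_length G X (\<psi> (val w))"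
    unfolding conj_length_def cls
  proof (rule Least_equality)
    show "\<exists>h\<in>\<psi> ` {h. conj_rel g h}. elt_length G X h = elt_length G X (\<psi> (val w))"
      using w(2) by blast
  next
    fix n assume "\<exists>h\<in>\<psi> ` {h. conj_rel g h}. elt_length G X h = n"
    then show "elt_length G X (\<psi> (val w)) \<le> n"
      using lower elt_length_le[of w] len by force
  qed
  then show ?thesis using lower[OF w(2)] elt_length_le[of w] len by simp
qed

lemma ConjGeo_eq: "ConjGeo G X = map gen ` {w. conj_geo w}"
proof -
  have "length w = conj_length G X (word_val G (map gen w)) \<longleftrightarrow> conj_geo w" for w
    using conj_length_eq[OF val_closed[of w]] conj_len_eq_iff_conj_geo[of w]
        by (auto simp: word_val_gen)
  then show ?thesis unfolding ConjGeo_def lists_X by auto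
qed

lemma Geo_iff: "map gen w \<in> Geo G X \<longleftrightarrow> (\<forall>v. val v = val w \<longrightarrow> length w \<le> length v)"
proof -
  obtain v where "val v = val w" "length v = elt_length G X (\<psi> (val w))"
    using elt_length_attained[OF val_closed] by blast
  moreover have "elt_length G X (\<psi> (val w)) \<le> length u" if "val u = val w" for u
    using elt_length_le[of u] that by simp
  ultimately have "length w = elt_length G X (\<psi> (val w)) \<longleftrightarrow>
      (\<forall>v. val v = val w \<longrightarrow> length w \<le> length v)"
    by (metis le_antisym)
  then show ?thesis unfolding Geo_def lists_X by (simp add: word_val_gen)
qed

lemma shortlex_least_gen:
  assumes "least_in W w"
  shows "shortlex_least gen_order (map gen ` W) = map gen w"
proof -
  have "(gen x, gen y) \<in> gen_order - Id \<longleftrightarrow> (x, y) \<in> letter_order - Id" for x y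
    using inj_gen by (auto simp: gen_order_def inj_eq)
  then have le: "shortlex_le gen_order (map gen u) (map gen v) \<longleftrightarrow> shortlex_le letter_order u v" for
      u v
    unfolding shortlex_le_def using lenlex_map[OF _ inj_gen] inj_map_eq_map[OF inj_gen] by metis
  show ?thesis unfolding shortlex_least_def
  proof (rule the_equality)
    show "map gen w \<in> map gen ` W \<and> (\<forall>v\<in>map gen ` W. shortlex_le gen_order (map gen w) v)"
      using assms le unfolding least_in_def by blast
  next
    fix v assume v: "v \<in> map gen ` W \<and> (\<forall>u\<in>map gen ` W. shortlex_le gen_order v u)"
    then obtain u where u: "v = map gen u" "u \<in> W" by blast
    then have "least_in W u" using v le unfolding least_in_def by blast
    then show "v = map gen w" using u(1) least_in_unique assms by blast
  qed
qed

lemma sl_elt_eq: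
  assumes "least w"
  shows "sl_elt G X gen_order (\<psi> (val w)) = map gen w"
  unfolding sl_elt_def words_of_elt[OF val_closed] using assms by (rule shortlex_least_gen)

lemma ex_least_val:
  assumes "g \<in> carrier SD"
  obtains w where "val w = g" "least w"
proof -
  obtain v where "val v = g" using ex_val[OF assms] by blast
  then obtain w where "least_in {u. val u = g} w" using ex_least_in[of "{u. val u = g}"] by blast
  then show ?thesis using that[of w] by (simp add: least_in_def)
qed

lemma SL_eq: "SL G X gen_order = map gen ` {w. least w}"
proof (intro equalityI subsetI)
  fix u assume "u \<in> SL G X gen_order"
  then obtain g where g: "g \<in> carrier SD" "u = sl_elt G X gen_order (\<psi> g)"
    unfolding SL_def carrier_G by blast
  obtain w where "val w = g" "least w" using ex_least_val[OF g(1)] .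
  then show "u \<in> map gen ` {w. least w}" using g(2) sl_elt_eq by blast
next
  fix u assume "u \<in> map gen ` {w. least w}"
  then obtain w where w: "least w" "u = map gen w" by blast
  then have "u = sl_elt G X gen_order (\<psi> (val w))" using sl_elt_eq by simp
  moreover have "\<psi> (val w) \<in> carrier G" using val_closed by simp
  ultimately show "u \<in> SL G X gen_order" unfolding SL_def by blast
qed

lemma least_minlen_iff:
  assumes "least w"
  shows "elt_length G X (\<psi> (val w)) = conj_length G X (\<psi> (val w)) \<longleftrightarrow> conj_geo w"
proof -
  obtain v where "val v = val w" "length v = elt_length G X (\<psi> (val w))"
    using elt_length_attained[OF val_closed] by blast
  then have "elt_length G X (\<psi> (val w)) = length w"
    using elt_length_le[of w] length_le_if_least_in[OF assms, of v] by simp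
  then show ?thesis using conj_length_eq[OF val_closed[of w]] conj_len_eq_iff_conj_geo[of w] by auto
qed

lemma ConjMinLenSL_eq: "ConjMinLenSL G X gen_order = map gen ` minlen_nf"
  unfolding minlen_nf_eq[symmetric]
proof (intro equalityI subsetI)
  fix u assume "u \<in> ConjMinLenSL G X gen_order"
  then obtain g where g: "g \<in> carrier SD" "u = sl_elt G X gen_order (\<psi> g)"
    "elt_length G X (\<psi> g) = conj_length G X (\<psi> g)"
    unfolding ConjMinLenSL_def carrier_G by blast
  obtain w where "val w = g" "least w" using ex_least_val[OF g(1)] .
  then show "u \<in> map gen ` {w. conj_geo w \<and> least w}" using g sl_elt_eq least_minlen_iff by blast
next
  fix u assume "u \<in> map gen ` {w. conj_geo w \<and> least w}"
  then obtain w where w: "conj_geo w" "least w" "u = map gen w" by blast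
  then have "elt_length G X (\<psi> (val w)) = conj_length G X (\<psi> (val w))" using least_minlen_iff
      by simp
  moreover have "u = sl_elt G X gen_order (\<psi> (val w))" using w sl_elt_eq by simp
  moreover have "\<psi> (val w) \<in> carrier G" using val_closed by simp
  ultimately show "u \<in> ConjMinLenSL G X gen_order" unfolding ConjMinLenSL_def by blast
qed

lemma sl_class_eq:
  assumes "class_least w"
  shows "sl_class G X gen_order (conj_class G (\<psi> (val w))) = map gen w"
  unfolding sl_class_def words_of_class[OF val_closed] using assms by (rule shortlex_least_gen)

lemma ConjSL_eq: "ConjSL G X gen_order = map gen ` class_nf"
  unfolding class_nf_eq[symmetric]
proof (intro equalityI subsetI)
  fix u assume "u \<in> ConjSL G X gen_order"
  then obtain g where g: "g \<in> carrier SD" "u = sl_class G X gen_order (conj_class G (\<psi> g))"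
    unfolding ConjSL_def carrier_G by blast
  obtain v where "val v = g" using ex_val[OF g(1)] by blast
  then obtain w where w: "least_in {v. conj_rel g (val v)} w"
    using ex_least_in[of "{v. conj_rel g (val v)}"] conj_rel_refl by blast
  have "u = map gen w"
    unfolding g(2) sl_class_def words_of_class[OF g(1)] using w by (rule shortlex_least_gen)
  moreover have "conj_rel g (val w)" using w by (simp add: least_in_def)
  then have "{v. conj_rel g (val v)} = same_class w" using conj_rel_sym conj_rel_trans by blast
  then have "class_least w" using w by simp
  ultimately show "u \<in> map gen ` {w. class_least w}" by blast
next
  fix u assume "u \<in> map gen ` {w. class_least w}"
  then obtain w where w: "class_least w" "u = map gen w" by blast
  then have "u = sl_class G X gen_order (conj_class G (\<psi> (val w)))" using sl_class_eq by simp
  moreover have "\<psi> (val w) \<in> carrier G" using val_closed by simp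
  ultimately show "u \<in> ConjSL G X gen_order" unfolding ConjSL_def by blast
qed

lemma linear_order_gen_order: "linear_order_on X gen_order"
proof -
  have mem: "(gen x, gen y) \<in> gen_order \<longleftrightarrow> rank x \<le> rank y" for x y
    using inj_gen by (auto simp: gen_order_def letter_order_def inj_eq)
  have "gen_order \<subseteq> X \<times> X" by (auto simp: gen_order_def X_def)
  moreover have "refl_on X gen_order" unfolding refl_on_def by (auto simp: X_def mem)
  moreover have "trans gen_order"
  proof (rule transI)
    fix x y z assume "(x, y) \<in> gen_order" "(y, z) \<in> gen_order"
    then show "(x, z) \<in> gen_order" using inj_gen
        by (fastforce simp: gen_order_def letter_order_def inj_eq)
  qed
  moreover have "antisym gen_order"
  proof (rule antisymI)
    fix x y assume "(x, y) \<in> gen_order" "(y, x) \<in> gen_order"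
    then obtain u v where "x = gen u" "y = gen v" by (auto simp: gen_order_def)
    with \<open>(x, y) \<in> gen_order\<close> \<open>(y, x) \<in> gen_order\<close> show "x = y" using mem
        by (metis le_antisym rank_inject)
  qed
  moreover have "total_on X gen_order" unfolding total_on_def X_def using mem by (auto simp: linear)
  ultimately show ?thesis
    by (simp add: linear_order_on_def partial_order_on_def preorder_on_def)
qed

lemma not_regular_map_gen:
  assumes "\<And>i j. i + 2 \<le> j \<Longrightarrow> map gen (blocks i j) \<in> L" "\<And>i j. j \<le> i \<Longrightarrow> map gen (blocks i j) \<notin> L"
  shows "\<not> regular_language X L"
  using assms by (intro not_regular_if_compares_blocks[of "gen (Lc True)" X "gen Lt"])
      (simp_all add: X_def)

theorem languages:
  "regular_language X (ConjGeo G X)" "\<not> regular_language X (Geo G X)" "linear_order_on X gen_order"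
  "regular_language X (ConjSL G X gen_order)" "regular_language X (ConjMinLenSL G X gen_order)"
  "\<not> regular_language X (SL G X gen_order)"
proof -
  show "regular_language X (ConjGeo G X)" "regular_language X (ConjSL G X gen_order)"
    "regular_language X (ConjMinLenSL G X gen_order)"
    unfolding ConjGeo_eq ConjSL_eq ConjMinLenSL_eq unfolding X_def
    by (intro regular_language_map inj_gen quotients_conj_geo quotients_class_nf
        quotients_minlen_nf)+
  show "linear_order_on X gen_order" by (rule linear_order_gen_order)
  show "\<not> regular_language X (Geo G X)"
  proof (rule not_regular_map_gen)
    show "map gen (blocks i j) \<in> Geo G X" if "i + 2 \<le> j" for i j
      unfolding Geo_iff using blocks_geodesic[OF that] by blast
    show "map gen (blocks i j) \<notin> Geo G X" if "j \<le> i" for i j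
      unfolding Geo_iff using blocks_not_geodesic[OF that] by (meson not_le)
  qed
  show "\<not> regular_language X (SL G X gen_order)"
  proof (rule not_regular_map_gen)
    show "map gen (blocks i j) \<in> SL G X gen_order" if "i + 2 \<le> j" for i j
      unfolding SL_eq using least_blocks[OF that] by blast
    show "map gen (blocks i j) \<notin> SL G X gen_order" if ji: "j \<le> i" for i j
    proof
      assume "map gen (blocks i j) \<in> SL G X gen_order"
      then obtain w where w: "least w" "map gen (blocks i j) = map gen w" unfolding SL_eq by blast
      then have "least (blocks i j)" by (simp only: inj_map_eq_map[OF inj_gen])
      moreover obtain v where v: "val v = val (blocks i j)" "length v < length (blocks i j)"
        using blocks_not_geodesic[OF ji] by blast
      then have "v \<in> same_val (blocks i j)" by (simp only: mem_Collect_eq)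
      ultimately have "length (blocks i j) \<le> length v" by (rule length_le_if_least_in)
      then show False using v(2) by linarith
    qed
  qed
qed

end

theorem proposition5p2:
  fixes G :: "'g monoid" and a b c d t :: 'g and X :: "'g set"
  assumes "group G"
    and "has_presentation G
      (\<lambda>x. case x of Gen_a \<Rightarrow> a | Gen_b \<Rightarrow> b | Gen_t \<Rightarrow> t) relations_abt"
    and "c = a [^]\<^bsub>G\<^esub> (2::nat)"
    and "d = a \<otimes>\<^bsub>G\<^esub> b"
    and "X = {a, inv\<^bsub>G\<^esub> a, c, inv\<^bsub>G\<^esub> c, d, inv\<^bsub>G\<^esub> d, t}"
  shows "G \<cong> semidirect_product (integer_group \<times>\<times> integer_group) (integer_mod_group 2) swap_action
    \<and> has_presentation G
        (\<lambda>x. case x of Gen'_a \<Rightarrow> a | Gen'_c \<Rightarrow> c | Gen'_d \<Rightarrow> d | Gen'_t \<Rightarrow> t) relations_acdt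
    \<and> regular_language X (ConjGeo G X)
    \<and> \<not> regular_language X (Geo G X)
    \<and> (\<exists>r. linear_order_on X r
        \<and> regular_language X (ConjSL G X r)
        \<and> regular_language X (ConjMinLenSL G X r)
        \<and> \<not> regular_language X (SL G X r))"
proof -
  \<comment> \<open>Two groups with the same presentation are isomorphic by a map that matches the
    generators, so the given group may be replaced by the concrete one.\<close>
  have "\<exists>\<psi>\<in>iso SD G. \<forall>x. \<psi> (sd_abt x) = (case x of Gen_a \<Rightarrow> a | Gen_b \<Rightarrow> b | Gen_t \<Rightarrow> t)"
    by (rule iso_if_has_presentation[OF has_presentation_SD_abt assms(2)]) blast
  then obtain \<psi> where \<psi>: "\<psi> \<in> iso SD G"
    and \<psi>_gen: "\<And>x. \<psi> (sd_abt x) = (case x of Gen_a \<Rightarrow> a | Gen_b \<Rightarrow> b | Gen_t \<Rightarrow> t)"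
    by blast
  interpret S: sd_iso G \<psi> by (rule sd_iso.intro) (fact assms(1) \<psi>)+
  interpret \<psi>: group_hom SD G \<psi>
    using group_SD assms(1) \<psi> by (simp add: group_hom_def group_hom_axioms_def iso_def)
  have abt: "\<psi> ((1, 0), 0) = a" "\<psi> ((0, 1), 0) = b" "\<psi> ((0, 0), 1) = t"
    using \<psi>_gen[of Gen_a] \<psi>_gen[of Gen_b] \<psi>_gen[of Gen_t] by simp_all
  have closed: "((i, j), 0) \<in> carrier SD" for i j by (simp add: carrier_SD)
  have [simp]: "a \<in> carrier G" using abt(1) closed \<psi>.hom_closed by metis
  have "c = a \<otimes>\<^bsub>G\<^esub> a" unfolding assms(3) by (simp add: numeral_2_eq_2)
  then have c: "\<psi> ((2, 0), 0) = c"
    using \<psi>.hom_mult[OF closed closed, of 1 0 1 0] abt(1) by simp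
  have d: "\<psi> ((1, 1), 0) = d"
    using \<psi>.hom_mult[OF closed closed, of 1 0 0 1] abt(1,2) assms(4) by simp
  have inv: "\<psi> ((- i, - j), 0) = inv\<^bsub>G\<^esub> \<psi> ((i, j), 0)" for i j
    using \<psi>.hom_inv[OF closed] by (simp add: inv_SD)
  have "range S.gen = S.gen ` {La True, La False, Lc True, Lc False, Ld True, Ld False, Lt}"
  proof -
    have "x \<in> {La True, La False, Lc True, Lc False, Ld True, Ld False, Lt}" for x
      by (cases x) auto
    then show ?thesis by blast
  qed
  also have "\<dots> = X"
    using abt(1,3) c d inv[of 1 0] inv[of 2 0] inv[of 1 1] by (simp add: S.gen_def assms(5))
  finally have X: "S.X = X" by (simp add: S.X_def)
  have "(\<lambda>x. \<psi> (sd_acdt x)) =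
      (\<lambda>x. case x of Gen'_a \<Rightarrow> a | Gen'_c \<Rightarrow> c | Gen'_d \<Rightarrow> d | Gen'_t \<Rightarrow> t)"
    using abt c d by (auto simp: fun_eq_iff split: gen_acdt.split)
  then have "has_presentation G
      (\<lambda>x. case x of Gen'_a \<Rightarrow> a | Gen'_c \<Rightarrow> c | Gen'_d \<Rightarrow> d | Gen'_t \<Rightarrow> t) relations_acdt"
    using has_presentation_iso[OF has_presentation_SD_acdt \<psi>] by simp
  moreover have "G \<cong> SD" using group.iso_sym[OF group_SD] \<psi> by (auto simp: is_iso_def)
  ultimately show ?thesis using S.languages unfolding X by blast
qed

end
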